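(* Fix $K>1$ and a distribution $F$ supported on $V_0=\{e_1,\ldots,e_K\}$ (the standard basis of $\mathbb{R}^K$), and let $h=\mathbb{E}[\pi_i]$ for $\pi_i\sim F$. Consider a sequence of DCBM model pairs indexed by $n$: $$H_0^{(n)}:\ \Omega=\theta\theta'\qquad\text{and}\qquad H_1^{(n)}:\ \Omega=\widetilde\Theta\Pi P\Pi'\widetilde\Theta,$$ where $\Pi=[\pi_1,\ldots,\pi_n]'$ with $\pi_i\stackrel{iid}{\sim}F$, and $\widetilde\Theta=\mathrm{diag}(\widetilde\theta_1,\ldots,\widetilde\theta_n)$ with $\widetilde\theta_i=d_k\theta_i$ if $\pi_i=e_k$; here $D=\mathrm{diag}(d_1,\ldots,d_K)$ is the unique diagonal matrix with positive diagonal entries such that $DPDh=1_K$. If $\theta_{\max}\le c_0$ for a constant $c_0<1$, $$\min_{1\le k\le K}\{h_k\}\ge C,\qquad\text{and}\qquad\|\theta\|\cdot|\mu_2(P)|\to0,$$ for a constant $C>0$, then for each pair of two hypotheses the $\chi^2$-distance between the two joint distributions tends to $0$ as $n\to\infty$.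
   Context: $\theta\in\mathbb{R}^n$ has positive entries; $P\in\mathbb{R}^{K\times K}$ is symmetric, entrywise nonnegative, with unit diagonal; $\theta$ and $P$ are non-stochastic and may depend on $n$. Given $\Omega$ (possibly random through $\Pi$), the adjacency matrix $A\in\{0,1\}^{n\times n}$ is symmetric with zero diagonal, and its entries $A_{ij}$, $i<j$, are conditionally independent Bernoulli with $\mathbb{P}(A_{ij}=1\mid\Omega)=\Omega_{ij}\in[0,1]$. The two joint distributions are the laws $P_0^{(n)}$, $P_1^{(n)}$ of $A$ under $H_0^{(n)}$ and $H_1^{(n)}$ (under $H_1^{(n)}$, averaged over $\Pi$). Their $\chi^2$-distance is $\int(dP_1^{(n)}/dP_0^{(n)})^2\,dP_0^{(n)}-1$. $\mu_k(P)$ is the $k$-th largest eigenvalue of $P$ in magnitude. $\|\theta\|$ is the $\ell^2$-norm, $\theta_{\max}=\max_i\theta_i$, $1_K$ is the all-ones vector. *)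

theory Defs
  imports "HOL-Probability.Probability" "HOL-Computational_Algebra.Polynomial"
begin

text \<open>
  The number of communities \<open>K\<close> is the cardinality of the index type \<open>'k\<close>. Since \<open>n\<close> tends to
  infinity, \<open>n\<close>-vectors and \<open>n \<times> n\<close> matrices are functions on \<open>nat\<close> of which only the indices
  \<open>i < n\<close> matter. Row \<open>i\<close> of the membership matrix \<open>\<Pi>\<close> is \<open>\<pi> i :: real ^ 'k\<close>.
\<close>

definition diag_mat :: "'a::zero ^ 'k \<Rightarrow> 'a ^ 'k ^ 'k" where
  "diag_mat d = (\<chi> i j. if i = j then d $ i else 0)"

definition ones_vec :: "real ^ 'k" where
  "ones_vec = (\<chi> i. 1)"

definition basis_vecs :: "(real ^ 'k) set" where
  "basis_vecs = range (\<lambda>k. axis k 1)"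

definition charpoly :: "real ^ 'k ^ 'k \<Rightarrow> real poly" where
  "charpoly M = det (\<chi> i j. (if i = j then [:0, 1:] else 0) - [:M $ i $ j:])"

text \<open>
  The eigenvalues are listed with algebraic multiplicity, by decreasing magnitude; \<open>k\<close> starts
  at 1. Only real eigenvalues are listed, which for symmetric \<open>M\<close> are all of them. Between two
  eigenvalues \<open>a\<close> and \<open>-a\<close> the order is immaterial as long as only \<open>\<bar>eig_mag k M\<bar>\<close> is used.
\<close>
definition eig_mag :: "nat \<Rightarrow> real ^ 'k ^ 'k \<Rightarrow> real" where
  "eig_mag k M =
     rev (sort_key abs (sorted_list_of_multiset (proots (charpoly M)))) ! (k - 1)"

definition mean_vec :: "(real ^ 'k) pmf \<Rightarrow> real ^ 'k" where
  "mean_vec F = measure_pmf.expectation F (\<lambda>x. x)"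

definition omega_null :: "(nat \<Rightarrow> real) \<Rightarrow> nat \<Rightarrow> nat \<Rightarrow> real" where
  "omega_null \<theta> i j = \<theta> i * \<theta> j"

definition theta_tilde ::
  "(nat \<Rightarrow> real) \<Rightarrow> real ^ 'k \<Rightarrow> (nat \<Rightarrow> real ^ 'k) \<Rightarrow> nat \<Rightarrow> real" where
  "theta_tilde \<theta> d \<pi> i = d $ (THE k. \<pi> i = axis k 1) * \<theta> i"

text \<open>The \<open>(i, j)\<close> entry of \<open>\<Theta>~ \<Pi> P \<Pi>' \<Theta>~\<close>, where \<open>\<Theta>~\<close> is the diagonal matrix of \<open>theta_tilde\<close>.\<close>
definition omega_alt ::
  "(nat \<Rightarrow> real) \<Rightarrow> real ^ 'k ^ 'k \<Rightarrow> real ^ 'k \<Rightarrow> (nat \<Rightarrow> real ^ 'k) \<Rightarrow> nat \<Rightarrow> nat \<Rightarrow> real" where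
  "omega_alt \<theta> P d \<pi> i j =
     theta_tilde \<theta> d \<pi> i * (\<pi> i \<bullet> (P *v \<pi> j)) * theta_tilde \<theta> d \<pi> j"

definition upper_pairs :: "nat \<Rightarrow> (nat \<times> nat) set" where
  "upper_pairs n = {(i, j). i < j \<and> j < n}"

text \<open>The symmetric 0/1 matrix with zero diagonal and the given strictly upper triangular part.\<close>
definition adj_of_upper :: "nat \<Rightarrow> (nat \<times> nat \<Rightarrow> bool) \<Rightarrow> nat \<Rightarrow> nat \<Rightarrow> nat" where
  "adj_of_upper n X i j =
     of_bool ((i, j) \<in> upper_pairs n \<and> X (i, j) \<or> (j, i) \<in> upper_pairs n \<and> X (j, i))"

text \<open>
  Meaningful only when the entries of \<open>\<Omega>\<close> above the diagonal lie in \<open>[0, 1]\<close>: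
  \<^const>\<open>bernoulli_pmf\<close> truncates other parameters.
\<close>
definition adj_law :: "nat \<Rightarrow> (nat \<Rightarrow> nat \<Rightarrow> real) \<Rightarrow> (nat \<Rightarrow> nat \<Rightarrow> nat) pmf" where
  "adj_law n \<Omega> =
     map_pmf (adj_of_upper n)
       (Pi_pmf (upper_pairs n) False (\<lambda>(i, j). bernoulli_pmf (\<Omega> i j)))"

definition null_law :: "nat \<Rightarrow> (nat \<Rightarrow> real) \<Rightarrow> (nat \<Rightarrow> nat \<Rightarrow> nat) pmf" where
  "null_law n \<theta> = adj_law n (omega_null \<theta>)"

definition alt_law ::
  "nat \<Rightarrow> (real ^ 'k) pmf \<Rightarrow> (nat \<Rightarrow> real) \<Rightarrow> real ^ 'k ^ 'k \<Rightarrow> real ^ 'k \<Rightarrow>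
     (nat \<Rightarrow> nat \<Rightarrow> nat) pmf" where
  "alt_law n F \<theta> P d =
     bind_pmf (Pi_pmf {..<n} 0 (\<lambda>_. F)) (\<lambda>\<pi>. adj_law n (omega_alt \<theta> P d \<pi>))"

text \<open>
  The Bochner integral is used on purpose: if \<open>N\<close> is not absolutely continuous with respect to
  \<open>M\<close>, or the integral diverges, the value is the junk value \<open>-1\<close> and not \<open>0\<close>.
\<close>
definition chi2_dist :: "'a measure \<Rightarrow> 'a measure \<Rightarrow> real" where
  "chi2_dist M N = (\<integral>x. (enn2real (RN_deriv M N x))\<^sup>2 \<partial>M) - 1"

end

theory Submission
  imports Defs
begin

text \<open>
  Write \<open>h\<close> for the mean vector and \<open>m k l = d k * d l * P k l - 1\<close>. Under the alternative the edge
  probability between nodes with labels \<open>k\<close> and \<open>l\<close> is \<open>\<theta> i * \<theta> j * (1 + m k l)\<close>, and the scaling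
  \<open>D P D h = 1\<close> says that \<open>m\<close> has mean zero in each argument when the label is drawn from \<open>h\<close>. Two facts
  give the theorem.

  The kernel is small: \<open>\<bar>m k l\<bar>\<close> is at most \<open>\<bar>\<mu>\<bar> / C\<close>, where \<open>\<mu>\<close> is the second eigenvalue of \<open>P\<close> in
  magnitude (\<open>second_eigenvalue_bounds_centred_kernel\<close>). Indeed \<open>D P D\<close> with columns weighted by \<open>h\<close> is
  a reversible Markov transition matrix, subtracting 1 removes its leading eigenvector, and what
  remains is controlled by \<open>\<mu>\<close> by the variational description of the second eigenvalue. That
  description comes from the spectral theorem for symmetric matrices.

  The kernel enters to second order only: with \<open>p = \<theta> i * \<theta> j\<close> for the edge \<open>e = (i, j)\<close>, the
  chi-square distance plus 1 equals the sum over all sets \<open>G\<close> of edges of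
  \<open>(\<Prod>e\<in>G. p / (1 - p)) * (E \<Prod>e\<in>G. m e)\<^sup>2\<close>, with \<open>E\<close> the mean over independent labels
  (\<open>chi2_dist_bernoulli_mixture\<close>, \<open>expectation_prod_one_plus_subgraph_sum\<close>). As \<open>m\<close> is centred, only \<open>G\<close>
  without a vertex of degree 1 contribute, and each squared mean is at most \<open>(\<mu> / C)\<^sup>2\<close> to the power of
  the number of edges of \<open>G\<close>. Let \<open>\<xi>\<close> be a centred two-point variable whose moments of order at least 2
  are all at least 1. For independent copies of \<open>\<xi>\<close>, the mean of \<open>\<Prod>(i, j)\<in>G. \<xi> i * \<xi> j\<close> is a
  product of moments over vertices; it vanishes if \<open>G\<close> has a leaf and is at least 1 if not. So the sum is
  bounded by the mean of \<open>\<Prod>(i, j). 1 + b i * b j * \<xi> i * \<xi> j\<close> with \<open>b i\<close> proportional to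
  \<open>\<bar>\<mu>\<bar> * \<theta> i\<close> (\<open>subgraph_mean_square_le_skew_sign\<close>). This scalar expression is at most
  \<open>1 / sqrt (1 - 9 / 4 * (\<Sum>i. (b i)\<^sup>2))\<close> once that sum is small
  (\<open>skew_sign_chaos_le\<close>), and the sum of the \<open>(b i)\<^sup>2\<close> is a constant
  times \<open>(\<mu> * norm \<theta>)\<^sup>2\<close>, which tends to 0 by assumption.
\<close>

section \<open>Spectral theorem and the second eigenvalue\<close>

text \<open>
  A maximiser \<open>v\<close> of \<open>x \<bullet> f x\<close> on the unit sphere of \<open>S\<close> is an eigenvector. Otherwise the residual
  \<open>r = f v - l *\<^sub>R v\<close>, which is orthogonal to \<open>v\<close>, would be nonzero, and moving from \<open>v\<close> a little in the
  direction \<open>r\<close> would increase the quotient to first order.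
\<close>
lemma symmetric_exists_unit_eigenvector:
  fixes f :: "'a::euclidean_space \<Rightarrow> 'a"
  assumes lin: "linear f" and sym: "\<And>x y. f x \<bullet> y = x \<bullet> f y"
    and S: "subspace S" "f ` S \<subseteq> S" "S \<noteq> {0}"
  obtains v l where "v \<in> S" "norm v = 1" "f v = l *\<^sub>R v"
proof -
  obtain s where s: "s \<in> S" "s \<noteq> 0"
    using S subspace_0 by blast
  have "s /\<^sub>R norm s \<in> S \<inter> sphere 0 1"
    using s S(1) by (simp add: subspace_scale)
  then have ne: "S \<inter> sphere 0 1 \<noteq> {}" by blast
  have cpt: "compact (S \<inter> sphere 0 1)"
    using S(1) by (simp add: closed_Int_compact closed_subspace)
  have cont: "continuous_on (S \<inter> sphere 0 1) (\<lambda>x. x \<bullet> f x)"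
    using lin by (intro continuous_intros linear_continuous_on) (simp add: linear_conv_bounded_linear)
  obtain v where v: "v \<in> S" "norm v = 1"
    and vmax: "\<And>y. y \<in> S \<Longrightarrow> norm y = 1 \<Longrightarrow> y \<bullet> f y \<le> v \<bullet> f v"
    using continuous_attains_sup[OF cpt ne cont] by auto
  define l where "l = v \<bullet> f v"
  define r where "r = f v - l *\<^sub>R v"
  have max': "y \<bullet> f y \<le> l * (y \<bullet> y)" if "y \<in> S" for y
  proof (cases "y = 0")
    case False
    have "(y /\<^sub>R norm y) \<bullet> f (y /\<^sub>R norm y) \<le> l"
      unfolding l_def using that False S(1) by (intro vmax) (auto simp: subspace_scale)
    then show ?thesis
      using False lin by (simp add: linear_scale field_simps dot_square_norm power2_eq_square)
  qed (use lin in \<open>simp add: linear_0\<close>)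
  have rS: "r \<in> S"
    using S v unfolding r_def by (auto intro!: subspace_diff subspace_scale)
  have vv: "v \<bullet> v = 1" using v by (simp add: dot_square_norm)
  have rv: "r \<bullet> v = 0" unfolding r_def by (simp add: inner_diff_left vv l_def inner_commute[of "f v" v])
  have rfv: "r \<bullet> f v = r \<bullet> r"
  proof -
    have "f v = r + l *\<^sub>R v" by (simp add: r_def)
    then show ?thesis using rv by (simp add: inner_add_right)
  qed
  \<comment> \<open>First and second order terms in \<open>t\<close> of the maximality inequality at \<open>v + t *\<^sub>R r\<close>.\<close>
  have key: "2 * t * (r \<bullet> r) \<le> t\<^sup>2 * (l * (r \<bullet> r) - r \<bullet> f r)" for t
  proof -
    have "(v + t *\<^sub>R r) \<bullet> f (v + t *\<^sub>R r) \<le> l * ((v + t *\<^sub>R r) \<bullet> (v + t *\<^sub>R r))"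
      using v rS S(1) by (intro max') (auto intro!: subspace_add subspace_scale)
    moreover have "v \<bullet> f r = r \<bullet> f v" using sym[of v r] by (simp add: inner_commute)
    ultimately show ?thesis
      using lin rv rfv vv
      by (simp add: linear_add linear_scale inner_add_left inner_add_right inner_commute[of v r]
          l_def[symmetric] power2_eq_square algebra_simps)
  qed
  have "r \<bullet> r = 0"
  proof (rule ccontr)
    assume "r \<bullet> r \<noteq> 0"
    then have pos: "r \<bullet> r > 0" by simp
    \<comment> \<open>With \<open>c\<close> bounding the second order coefficient, \<open>t = r \<bullet> r / c\<close> makes the first order term win.\<close>
    define c where "c = \<bar>l * (r \<bullet> r) - r \<bullet> f r\<bar> + 1"
    have c: "c > 0" "l * (r \<bullet> r) - r \<bullet> f r \<le> c" by (auto simp: c_def)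
    have "2 * (r \<bullet> r / c) * (r \<bullet> r) \<le> (r \<bullet> r / c)\<^sup>2 * c"
      by (rule order_trans[OF key]) (intro mult_left_mono c zero_le_power2)
    then have "(r \<bullet> r) * (r \<bullet> r) \<le> 0" using c(1) by (simp add: power2_eq_square field_simps)
    then show False using mult_pos_pos[OF pos pos] by linarith
  qed
  then have "f v = l *\<^sub>R v" by (simp add: r_def)
  with v that show ?thesis by blast
qed

text \<open>
  The orthogonal complement of an eigenvector inside \<open>S\<close> is again invariant, by symmetry of \<open>f\<close>, and
  has smaller dimension.
\<close>
lemma symmetric_orthonormal_eigenbasis_subspace:
  fixes f :: "'a::euclidean_space \<Rightarrow> 'a"
  assumes lin: "linear f" and sym: "\<And>x y. f x \<bullet> y = x \<bullet> f y"
    and "subspace S" "f ` S \<subseteq> S"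
  shows "\<exists>B. B \<subseteq> S \<and> pairwise orthogonal B \<and> (\<forall>v\<in>B. norm v = 1 \<and> (\<exists>l. f v = l *\<^sub>R v))
           \<and> card B = dim S \<and> finite B"
  using assms(3,4)
proof (induction "dim S" arbitrary: S rule: less_induct)
  case less
  show ?case
  proof (cases "S = {0}")
    case True
    then show ?thesis by (intro exI[of _ "{}"]) auto
  next
    case False
    obtain v l where v: "v \<in> S" "norm v = 1" "f v = l *\<^sub>R v"
      using symmetric_exists_unit_eigenvector[OF lin sym less.prems False] by blast
    define T where "T = {y \<in> S. orthogonal v y}"
    have dT: "dim T + 1 = dim S"
    proof -
      have "dim {y \<in> S. \<forall>x\<in>span {v}. orthogonal x y} + dim (span {v}) = dim S"
        using v less.prems by (intro dim_subspace_orthogonal_to_vectors) (auto simp: span_minimal)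
      moreover have "{y \<in> S. \<forall>x\<in>span {v}. orthogonal x y} = T"
        unfolding T_def span_singleton by (auto simp: orthogonal_def dest: bspec[of _ _ v] intro: rangeI[of _ 1, simplified])
      moreover have "v \<noteq> 0" using v by auto
      ultimately show ?thesis by (simp add: dim_span dim_singleton)
    qed
    have sT: "subspace T"
      using less.prems(1) unfolding T_def orthogonal_def subspace_def by (auto simp: inner_add_right)
    have fT: "f ` T \<subseteq> T"
    proof
      fix y assume "y \<in> f ` T"
      then obtain x where x: "x \<in> S" "v \<bullet> x = 0" "y = f x" by (auto simp: T_def orthogonal_def)
      have "v \<bullet> f x = f v \<bullet> x" by (simp add: sym)
      then show "y \<in> T" using x v less.prems(2) by (auto simp: T_def orthogonal_def)
    qed
    from less.hyps[OF _ sT fT] dT obtain B where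
      B: "B \<subseteq> T" "pairwise orthogonal B" "\<forall>v\<in>B. norm v = 1 \<and> (\<exists>l. f v = l *\<^sub>R v)"
         "card B = dim T" "finite B" by auto
    have vB: "v \<notin> B" using B(1) v(2) by (auto simp: T_def orthogonal_def)
    show ?thesis
    proof (intro exI[of _ "insert v B"] conjI)
      show "pairwise orthogonal (insert v B)"
        using B(1,2) by (auto simp: pairwise_insert T_def orthogonal_commute)
    qed (use B v vB dT in \<open>auto simp: T_def\<close>)
  qed
qed

text \<open>
  The basis is indexed by the index type of the matrix so that it can serve as the columns of a square
  matrix.
\<close>
lemma symmetric_matrix_orthonormal_eigenbasis:
  fixes A :: "real ^ 'k ^ 'k::finite"
  assumes "transpose A = A"
  obtains v :: "'k \<Rightarrow> real ^ 'k" and l :: "'k \<Rightarrow> real"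
  where "\<And>i j. v i \<bullet> v j = (if i = j then 1 else 0)" "\<And>i. A *v v i = l i *\<^sub>R v i"
proof -
  have sym: "(A *v x) \<bullet> y = x \<bullet> (A *v y)" for x y
    by (metis assms dot_lmul_matrix inner_commute transpose_matrix_vector)
  obtain B where B: "pairwise orthogonal B" "\<forall>v\<in>B. norm v = 1 \<and> (\<exists>l. A *v v = l *\<^sub>R v)"
       "card B = dim (UNIV :: (real^'k) set)" "finite B"
    using symmetric_orthonormal_eigenbasis_subspace[of "(*v) A" UNIV] sym by auto
  have "card B = card (UNIV :: 'k set)" using B(3) by simp
  then obtain v :: "'k \<Rightarrow> real ^ 'k" where v: "bij_betw v UNIV B"
    using B(4) by (metis finite_same_card_bij finite)
  obtain l where l: "\<And>b. b \<in> B \<Longrightarrow> A *v b = l b *\<^sub>R b" using B(2) by metis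
  show ?thesis
  proof (rule that[of v "l \<circ> v"])
    fix i j
    have vB: "v i \<in> B" "v j \<in> B" and inj: "i \<noteq> j \<Longrightarrow> v i \<noteq> v j"
      using v by (auto simp: bij_betw_def inj_def)
    show "v i \<bullet> v j = (if i = j then 1 else 0)"
      using vB inj B(1,2) by (auto simp: pairwise_def orthogonal_def dot_square_norm)
    show "A *v v i = (l \<circ> v) i *\<^sub>R v i" using l vB by simp
  qed
qed

text \<open>
  The identity \<open>X Q = Q D\<close> is read over the ring of polynomials: \<open>X\<close> is the characteristic matrix,
  the columns of \<open>Q\<close> are the eigenvectors and \<open>D\<close> is diagonal with entries \<open>x - l i\<close>. Determinants of
  such matrices are multiplicative, and \<open>det Q\<close> is invertible because \<open>Q\<close> is orthogonal.
\<close>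
lemma charpoly_orthonormal_eigenbasis:
  fixes A :: "real ^ 'k ^ 'k::finite" and v :: "'k \<Rightarrow> real ^ 'k" and l :: "'k \<Rightarrow> real"
  assumes on: "\<And>i j. v i \<bullet> v j = (if i = j then 1 else 0)" and ev: "\<And>i. A *v v i = l i *\<^sub>R v i"
  shows "charpoly A = (\<Prod>i\<in>UNIV. [:- l i, 1:])"
proof -
  define Q :: "real poly ^ 'k ^ 'k" where "Q = (\<chi> i j. [:v j $ i:])"
  define X :: "real poly ^ 'k ^ 'k" where "X = (\<chi> i j. (if i = j then [:0, 1:] else 0) - [:A $ i $ j:])"
  define D :: "real poly ^ 'k ^ 'k" where "D = (\<chi> i j. if i = j then [:- l i, 1:] else 0)"
  have sum_const: "(\<Sum>k\<in>UNIV. [:g k:]) = [:\<Sum>k\<in>UNIV. g k:]" for g :: "'k \<Rightarrow> real"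
    by (simp add: poly_eq_iff coeff_sum coeff_pCons split: nat.split)
  have "X ** Q = Q ** D"
  proof -
    have "(X ** Q) $ i $ j = (Q ** D) $ i $ j" for i j
    proof -
      have e: "(\<Sum>k\<in>UNIV. A $ i $ k * v j $ k) = l j * v j $ i"
        using arg_cong[OF ev[of j], of "\<lambda>x. x $ i"] by (simp add: matrix_vector_mult_def)
      have "(X ** Q) $ i $ j = (\<Sum>k\<in>UNIV. (if i = k then [:0, 1:] * [:v j $ k:] else 0)) -
              (\<Sum>k\<in>UNIV. [:A $ i $ k * v j $ k:])"
        unfolding sum_subtractf[symmetric]
        by (auto simp: matrix_matrix_mult_def X_def Q_def intro!: sum.cong)
      also have "\<dots> = [:0, 1:] * [:v j $ i:] - [:l j * v j $ i:]"
        unfolding sum_const e by (simp del: mult_pCons_left mult_pCons_right)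
      also have "\<dots> = [:v j $ i:] * [:- l j, 1:]" by simp
      also have "\<dots> = (\<Sum>k\<in>UNIV. if k = j then [:v j $ i:] * [:- l j, 1:] else 0)"
        by (simp del: mult_pCons_left mult_pCons_right)
      also have "\<dots> = (Q ** D) $ i $ j"
        unfolding matrix_matrix_mult_def D_def Q_def vec_lambda_beta
        by (rule sum.cong) (simp_all only: if_distrib mult_zero_right split: if_split, simp)
      finally show ?thesis .
    qed
    then show ?thesis by (simp add: vec_eq_iff)
  qed
  then have "det X * det Q = det Q * det D" by (metis det_mul)
  moreover have "transpose Q ** Q = mat 1"
  proof -
    have "(transpose Q ** Q) $ i $ j = mat 1 $ i $ j" for i j
    proof -
      have "(transpose Q ** Q) $ i $ j = [:\<Sum>k\<in>UNIV. v i $ k * v j $ k:]"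
        unfolding sum_const[symmetric] by (simp add: matrix_matrix_mult_def transpose_def Q_def mult.commute)
      also have "(\<Sum>k\<in>UNIV. v i $ k * v j $ k) = (if i = j then 1 else 0)"
        using on[of i j] by (simp add: inner_vec_def)
      finally show ?thesis by (simp add: mat_def one_pCons)
    qed
    then show ?thesis by (simp add: vec_eq_iff)
  qed
  then have "det Q \<noteq> 0"
    by (metis det_I det_mul mult_zero_right zero_neq_one)
  ultimately have "det X = det D" by (simp add: mult.commute)
  also have "\<dots> = (\<Prod>i\<in>UNIV. [:- l i, 1:])"
    by (subst det_diagonal) (auto simp: D_def)
  finally show ?thesis by (simp add: charpoly_def X_def)
qed

text \<open>
  The exceptional index belongs to the head of the list of eigenvalues; removing that one occurrence
  leaves entries that all come at or after the second position. Counting with multiplicity matters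
  here: a double eigenvalue of largest magnitude is also the second one.
\<close>
lemma eig_mag_second_bounds_all_but_one:
  fixes A :: "real ^ 'k ^ 'k::finite" and l :: "'k \<Rightarrow> real"
  assumes cp: "charpoly A = (\<Prod>i\<in>UNIV. [:- l i, 1:])" and K: "CARD('k) > 1"
  obtains i0 where "\<And>i. i \<noteq> i0 \<Longrightarrow> \<bar>l i\<bar> \<le> \<bar>eig_mag 2 A\<bar>"
proof -
  define L where "L = rev (sort_key abs (sorted_list_of_multiset (proots (charpoly A))))"
  have "mset L = (\<Sum>i\<in>UNIV. {#l i#})"
    unfolding L_def cp by (subst proots_prod) auto
  then have L: "mset L = image_mset l (mset_set UNIV)"
    by (simp add: sum_unfold_sum_mset image_mset.compositionality)
  have len: "length L = CARD('k)" using arg_cong[OF L, of size] by simp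
  have dec: "\<bar>L ! q\<bar> \<le> \<bar>L ! p\<bar>" if "p \<le> q" "q < length L" for p q
  proof -
    have "sorted_wrt (\<lambda>x y. \<bar>y\<bar> \<le> \<bar>x\<bar>) L"
      unfolding L_def sorted_wrt_rev using sorted_sort_key[of abs] by (simp add: sorted_map)
    then show ?thesis using that by (cases "p = q") (auto simp: sorted_wrt_iff_nth_less)
  qed
  obtain x y zs where Lc: "L = x # y # zs"
    using len K by (cases L; cases "tl L") auto
  have "x \<in># image_mset l (mset_set UNIV)" using L Lc by (metis list.set_intros(1) set_mset_mset)
  then obtain i0 where i0: "x = l i0" by auto
  have "\<bar>l i\<bar> \<le> \<bar>eig_mag 2 A\<bar>" if "i \<noteq> i0" for i
  proof -
    have "mset (y # zs) = image_mset l (mset_set UNIV) - {#l i0#}"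
      unfolding L[symmetric] Lc i0 by simp
    also have "\<dots> = image_mset l (mset_set UNIV - {#i0#})"
      by (subst image_mset_Diff) auto
    also have "mset_set UNIV - {#i0#} = mset_set (UNIV - {i0})"
      by (subst mset_set_Diff) auto
    finally have "set (y # zs) = l ` (UNIV - {i0})" 
      by (metis (no_types, lifting) finite_set_mset_mset_set finite set_image_mset set_mset_mset)
    then have "l i \<in> set (y # zs)" using that by blast
    then obtain q where "q < length (y # zs)" "(y # zs) ! q = l i" by (auto simp only: in_set_conv_nth)
    then have "\<bar>l i\<bar> \<le> \<bar>L ! 1\<bar>" using dec[of 1 "Suc q"] Lc by auto
    then show ?thesis by (simp add: eig_mag_def L_def)
  qed
  then show ?thesis using that by blast
qed

lemma orthonormal_parseval:
  fixes v :: "'k::finite \<Rightarrow> real ^ 'k"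
  assumes on: "\<And>i j. v i \<bullet> v j = (if i = j then 1 else 0)"
  shows "(\<Sum>i\<in>UNIV. (v i \<bullet> y)\<^sup>2) = y \<bullet> y"
proof -
  define Q :: "real ^ 'k ^ 'k" where "Q = (\<chi> i. v i)"
  have "orthogonal_matrix Q"
    unfolding orthogonal_matrix_orthonormal_rows using on
    by (auto simp: Q_def row_def vec_lambda_eta norm_eq_1 orthogonal_def)
  then have "orthogonal_transformation ((*v) Q)" by (simp add: orthogonal_transformation_matrix matrix_vector_mul_linear)
  then have "(Q *v y) \<bullet> (Q *v y) = y \<bullet> y" by (simp add: orthogonal_transformation_def)
  moreover have "(Q *v y) $ i = v i \<bullet> y" for i
    by (simp add: matrix_vector_mult_def Q_def inner_vec_def)
  ultimately show ?thesis by (simp add: inner_vec_def power2_eq_square)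
qed

text \<open>
  This is the only form in which eigenvalues enter the rest of the proof: away from one direction,
  a symmetric matrix stretches by at most its second eigenvalue in magnitude.
\<close>
lemma eig_mag_second_contracts_hyperplane:
  fixes A :: "real ^ 'k ^ 'k::finite"
  assumes sym: "transpose A = A" and K: "CARD('k) > 1"
  obtains v where "\<And>y. v \<bullet> y = 0 \<Longrightarrow> (A *v y) \<bullet> (A *v y) \<le> (eig_mag 2 A)\<^sup>2 * (y \<bullet> y)"
proof -
  obtain v :: "'k \<Rightarrow> real ^ 'k" and l where on: "\<And>i j. v i \<bullet> v j = (if i = j then 1 else 0)"
    and ev: "\<And>i. A *v v i = l i *\<^sub>R v i"
    using symmetric_matrix_orthonormal_eigenbasis[OF sym] by blast
  obtain i0 where i0: "\<And>i. i \<noteq> i0 \<Longrightarrow> \<bar>l i\<bar> \<le> \<bar>eig_mag 2 A\<bar>"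
    using eig_mag_second_bounds_all_but_one[OF charpoly_orthonormal_eigenbasis[OF on ev] K] by blast
  show ?thesis
  proof (rule that[of "v i0"])
    fix y assume y: "v i0 \<bullet> y = 0"
    have co: "v i \<bullet> (A *v y) = l i * (v i \<bullet> y)" for i
      by (metis ev dot_lmul_matrix inner_scaleR_left sym transpose_matrix_vector)
    have "(A *v y) \<bullet> (A *v y) = (\<Sum>i\<in>UNIV. (l i)\<^sup>2 * (v i \<bullet> y)\<^sup>2)"
      unfolding orthonormal_parseval[OF on, symmetric] co by (simp add: power_mult_distrib)
    also have "\<dots> \<le> (\<Sum>i\<in>UNIV. (eig_mag 2 A)\<^sup>2 * (v i \<bullet> y)\<^sup>2)"
    proof (rule sum_mono)
      fix i show "(l i)\<^sup>2 * (v i \<bullet> y)\<^sup>2 \<le> (eig_mag 2 A)\<^sup>2 * (v i \<bullet> y)\<^sup>2"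
        using i0[of i] y by (cases "i = i0") (auto simp: abs_le_square_iff intro!: mult_right_mono)
    qed
    also have "\<dots> = (eig_mag 2 A)\<^sup>2 * (y \<bullet> y)"
      unfolding orthonormal_parseval[OF on, symmetric] by (simp add: sum_distrib_left)
    finally show "(A *v y) \<bullet> (A *v y) \<le> (eig_mag 2 A)\<^sup>2 * (y \<bullet> y)" .
  qed
qed

section \<open>Reversible Markov kernels and the centred connection matrix\<close>

text \<open>
  The matrix \<open>w k l = d k * P k l * d l * h l\<close> is a transition matrix, reversible with respect to \<open>h\<close>.
  By Jensen's inequality its operator \<open>B\<close> is a contraction of the space of functions with the norm
  \<open>N f = (\<Sum>k. h k * (f k)\<^sup>2)\<close>, and it fixes constants. Since \<open>(d k)\<^sup>2 * h k \<le> 1\<close> by the unit diagonal,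
  passing from \<open>B\<close> to \<open>P\<close> by the scaling \<open>f \<mapsto> d h f\<close> loses nothing, so \<open>B\<close> stretches by at most
  \<open>\<bar>\<mu>\<bar> = \<bar>eig_mag 2 P\<bar>\<close> on a hyperplane of functions. In the plane spanned by the constants and a
  function \<open>f\<close> of \<open>h\<close>-mean zero there is a vector of that hyperplane; as \<open>B\<close> keeps the two directions
  orthogonal and does not shrink constants, the stretching by at most \<open>\<bar>\<mu>\<bar>\<close> must be true of \<open>f\<close> if
  \<open>\<bar>\<mu>\<bar> < 1\<close>; in the other case it follows from the contraction.
  The claim is the case where \<open>f\<close> is a centred point mass.
\<close>
lemma second_eigenvalue_bounds_centred_kernel:
  fixes P :: "real ^ 'k ^ 'k::finite" and d h :: "'k \<Rightarrow> real"
  assumes K: "CARD('k) > 1" and sym: "transpose P = P" and nonneg: "\<And>k l. P $ k $ l \<ge> 0"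
    and diag: "\<And>k. P $ k $ k = 1" and d: "\<And>k. d k > 0" and h: "\<And>k. h k > 0"
    and h1: "(\<Sum>k\<in>UNIV. h k) = 1"
    and stoch: "\<And>k. (\<Sum>l\<in>UNIV. d k * P $ k $ l * d l * h l) = 1"
  shows "h k * h l * (d k * d l * P $ k $ l - 1)\<^sup>2 \<le> (eig_mag 2 P)\<^sup>2"
proof -
  define \<mu> where "\<mu> = eig_mag 2 P"
  obtain v where v: "\<And>y. v \<bullet> y = 0 \<Longrightarrow> (P *v y) \<bullet> (P *v y) \<le> \<mu>\<^sup>2 * (y \<bullet> y)"
    unfolding \<mu>_def using eig_mag_second_contracts_hyperplane[OF sym K] by blast
  define w where "w k l = d k * P $ k $ l * d l * h l" for k l
  define B where "B f k = (\<Sum>l\<in>UNIV. w k l * f l)" for f :: "'k \<Rightarrow> real" and k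
  define N where "N f = (\<Sum>k\<in>UNIV. h k * (f k)\<^sup>2)" for f :: "'k \<Rightarrow> real"
  define M where "M f = (\<Sum>k\<in>UNIV. h k * f k)" for f :: "'k \<Rightarrow> real"
  have Psym: "P $ k $ l = P $ l $ k" for k l
    using arg_cong[OF sym, of "\<lambda>A. A $ l $ k"] by (simp add: transpose_def)
  have w0: "w k l \<ge> 0" for k l
    using d h nonneg by (simp add: w_def less_imp_le)
  have w1: "(\<Sum>l\<in>UNIV. w k l) = 1" for k using stoch[of k] by (simp add: w_def)
  have wh: "h k * w k l = h l * w l k" for k l
    by (simp add: w_def Psym[of k l])
  have col: "(\<Sum>k\<in>UNIV. h k * w k l) = h l" for l
    by (subst wh) (simp add: w1 flip: sum_distrib_left)
  have MB: "M (B f) = M f" for f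
  proof -
    have "M (B f) = (\<Sum>k\<in>UNIV. \<Sum>l\<in>UNIV. h k * w k l * f l)"
      by (simp add: M_def B_def sum_distrib_left mult_ac)
    also have "\<dots> = (\<Sum>l\<in>UNIV. (\<Sum>k\<in>UNIV. h k * w k l) * f l)"
      by (subst sum.swap) (simp add: sum_distrib_right)
    finally show ?thesis by (simp add: col M_def)
  qed
  have N0: "N f \<ge> 0" for f
    unfolding N_def using h by (intro sum_nonneg) (simp add: less_imp_le)
  have contr: "N (B f) \<le> N f" for f
  proof -
    have jensen: "(B f k)\<^sup>2 \<le> (\<Sum>l\<in>UNIV. w k l * (f l)\<^sup>2)" for k
    proof -
      have "0 \<le> (\<Sum>l\<in>UNIV. w k l * (f l - B f k)\<^sup>2)"
        by (intro sum_nonneg) (simp add: w0)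
      also have "\<dots> = (\<Sum>l\<in>UNIV. w k l * (f l)\<^sup>2 - 2 * B f k * (w k l * f l) + (B f k)\<^sup>2 * w k l)"
        by (intro sum.cong) (auto simp: power2_eq_square algebra_simps)
      also have "\<dots> = (\<Sum>l\<in>UNIV. w k l * (f l)\<^sup>2) - 2 * B f k * B f k + (B f k)\<^sup>2 * 1"
        by (simp add: sum.distrib sum_subtractf w1 B_def flip: sum_distrib_left)
      finally show ?thesis by (simp add: power2_eq_square)
    qed
    have "N (B f) \<le> (\<Sum>k\<in>UNIV. h k * (\<Sum>l\<in>UNIV. w k l * (f l)\<^sup>2))"
      unfolding N_def using h by (intro sum_mono mult_left_mono jensen) (simp add: less_imp_le)
    also have "\<dots> = (\<Sum>l\<in>UNIV. (\<Sum>k\<in>UNIV. h k * w k l) * (f l)\<^sup>2)"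
      by (simp add: sum_distrib_left sum_distrib_right mult_ac) (rule sum.swap)
    finally show ?thesis by (simp add: col N_def)
  qed
  have dh: "(d k)\<^sup>2 * h k \<le> 1" for k
  proof -
    have "w k k \<le> (\<Sum>l\<in>UNIV. w k l)" by (rule member_le_sum) (auto simp: w0)
    then show ?thesis using w1 by (simp add: w_def diag power2_eq_square)
  qed
  have hyper: "N (B f) \<le> \<mu>\<^sup>2 * N f" if "v \<bullet> (\<chi> l. d l * h l * f l) = 0" for f
  proof -
    define g :: "real ^ 'k" where "g = (\<chi> l. d l * h l * f l)"
    have Bg: "B f k = d k * (P *v g) $ k" for k
      by (simp add: B_def w_def g_def matrix_vector_mult_def sum_distrib_left mult_ac)
    have "N (B f) = (\<Sum>k\<in>UNIV. ((d k)\<^sup>2 * h k) * ((P *v g) $ k)\<^sup>2)"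
      by (simp add: N_def Bg power_mult_distrib mult_ac)
    also have "\<dots> \<le> (\<Sum>k\<in>UNIV. 1 * ((P *v g) $ k)\<^sup>2)"
      by (intro sum_mono mult_right_mono dh) auto
    also have "\<dots> = (P *v g) \<bullet> (P *v g)" by (simp add: inner_vec_def power2_eq_square)
    also have "\<dots> \<le> \<mu>\<^sup>2 * (g \<bullet> g)" using that v by (simp add: g_def)
    also have "g \<bullet> g = (\<Sum>k\<in>UNIV. ((d k)\<^sup>2 * h k) * (h k * (f k)\<^sup>2))"
      by (simp add: inner_vec_def g_def power2_eq_square mult_ac)
    also have "\<mu>\<^sup>2 * \<dots> \<le> \<mu>\<^sup>2 * (\<Sum>k\<in>UNIV. 1 * (h k * (f k)\<^sup>2))"
      using h by (intro mult_left_mono sum_mono mult_right_mono dh) (auto simp: less_imp_le)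
    finally show ?thesis by (simp add: N_def)
  qed
  have pyth: "N (\<lambda>k. a + b * f k) = a\<^sup>2 + b\<^sup>2 * N f" if "M f = 0" for a b f
  proof -
    have "N (\<lambda>k. a + b * f k) = (\<Sum>k\<in>UNIV. a\<^sup>2 * h k + 2 * a * b * (h k * f k) + b\<^sup>2 * (h k * (f k)\<^sup>2))"
      unfolding N_def by (intro sum.cong) (auto simp: power2_eq_square algebra_simps)
    also have "\<dots> = a\<^sup>2 * 1 + 2 * a * b * M f + b\<^sup>2 * N f"
      by (simp add: sum.distrib h1 N_def M_def flip: sum_distrib_left)
    finally show ?thesis using that by simp
  qed
  have Baff: "B (\<lambda>k. a + b * f k) = (\<lambda>k. a + b * B f k)" for a b f
  proof
    fix k
    have "B (\<lambda>k. a + b * f k) k = (\<Sum>l\<in>UNIV. a * w k l + b * (w k l * f l))"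
      unfolding B_def by (intro sum.cong) (auto simp: algebra_simps)
    also have "\<dots> = a + b * B f k"
      by (simp add: sum.distrib B_def w1 flip: sum_distrib_left)
    finally show "B (\<lambda>k. a + b * f k) k = a + b * B f k" .
  qed
  \<comment> \<open>The vector \<open>a + b * f\<close> below lies in the hyperplane on which \<open>hyper\<close> applies.\<close>
  have gap: "N (B f) \<le> \<mu>\<^sup>2 * N f" if "M f = 0" for f
  proof (rule ccontr)
    assume big: "\<not> N (B f) \<le> \<mu>\<^sup>2 * N f"
    have mu: "\<mu>\<^sup>2 < 1"
    proof (rule ccontr)
      assume "\<not> \<mu>\<^sup>2 < 1"
      then have "1 * N f \<le> \<mu>\<^sup>2 * N f" using N0 by (intro mult_right_mono) auto
      then show False using big contr[of f] by simp
    qed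
    define p where "p = v \<bullet> (\<chi> l. d l * h l)"
    define q where "q = v \<bullet> (\<chi> l. d l * h l * f l)"
    obtain a b where ab: "a * p + b * q = 0" "a \<noteq> 0 \<or> b \<noteq> 0"
    proof (cases "q = 0")
      case True then show ?thesis using that[of 0 1] by simp
    next
      case False then show ?thesis using that[of q "-p"] by (simp add: mult.commute)
    qed
    have "(\<chi> l. d l * h l * (a + b * f l)) = a *\<^sub>R (\<chi> l. d l * h l) + b *\<^sub>R (\<chi> l. d l * h l * f l)"
      by (simp add: vec_eq_iff algebra_simps)
    then have "v \<bullet> (\<chi> l. d l * h l * (a + b * f l)) = a * p + b * q"
      by (simp add: inner_add_right p_def q_def)
    then have "N (B (\<lambda>k. a + b * f k)) \<le> \<mu>\<^sup>2 * N (\<lambda>k. a + b * f k)"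
      using ab by (intro hyper) simp
    then have le: "a\<^sup>2 + b\<^sup>2 * N (B f) \<le> \<mu>\<^sup>2 * (a\<^sup>2 + b\<^sup>2 * N f)"
      by (simp add: Baff pyth that MB)
    have nn: "0 \<le> a\<^sup>2 * (1 - \<mu>\<^sup>2)" "0 \<le> b\<^sup>2 * (N (B f) - \<mu>\<^sup>2 * N f)"
      using mu big by auto
    have "a\<^sup>2 * (1 - \<mu>\<^sup>2) + b\<^sup>2 * (N (B f) - \<mu>\<^sup>2 * N f) \<le> 0"
      using le by (simp add: algebra_simps)
    then have "a\<^sup>2 * (1 - \<mu>\<^sup>2) = 0 \<and> b\<^sup>2 * (N (B f) - \<mu>\<^sup>2 * N f) = 0" using nn by linarith
    then show False using ab(2) mu big by auto
  qed
  define f where "f k = (if k = l then 1 / h l else 0) - 1" for k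
  have hl: "h l > 0" by (rule h)
  have Mf: "M f = 0"
  proof -
    have "M f = (\<Sum>k\<in>UNIV. (if k = l then 1 else 0) - h k)"
      unfolding M_def f_def using hl by (intro sum.cong) (auto simp: right_diff_distrib)
    also have "\<dots> = 0" by (simp add: sum_subtractf h1)
    finally show ?thesis .
  qed
  have Nf: "N f \<le> 1 / h l"
  proof -
    have "N f = (\<Sum>k\<in>UNIV. (if k = l then 1 / h l - 2 else 0) + h k)"
      unfolding N_def f_def using hl
      by (intro sum.cong) (auto simp: power2_eq_square field_simps)
    also have "\<dots> = 1 / h l - 2 + 1" by (simp add: sum.distrib h1)
    finally show ?thesis by simp
  qed
  have Bf: "B f k = d k * d l * P $ k $ l - 1"
  proof -
    have "B f k = (\<Sum>j\<in>UNIV. (if j = l then w k j / h l else 0) - w k j)"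
      unfolding B_def f_def by (intro sum.cong) (auto simp: right_diff_distrib)
    also have "\<dots> = w k l / h l - 1" by (simp add: sum_subtractf w1)
    finally show ?thesis using hl by (simp add: w_def mult_ac)
  qed
  have "h k * (B f k)\<^sup>2 \<le> N (B f)"
    unfolding N_def using h by (intro member_le_sum) (auto simp: less_imp_le)
  also have "\<dots> \<le> \<mu>\<^sup>2 * N f" by (rule gap[OF Mf])
  also have "\<dots> \<le> \<mu>\<^sup>2 * (1 / h l)" by (intro mult_left_mono Nf) auto
  finally show ?thesis using hl by (simp add: Bf \<mu>_def field_simps)
qed

section \<open>Chi-square distance of a mixture of product laws\<close>

lemma chi2_dist_pmf:
  assumes sub: "set_pmf r \<subseteq> set_pmf q"
  shows "chi2_dist (measure_pmf q) (measure_pmf r) =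
           measure_pmf.expectation q (\<lambda>x. (pmf r x / pmf q x)\<^sup>2) - 1"
proof -
  have "density (measure_pmf q) (\<lambda>x. ennreal (pmf r x / pmf q x)) =
          density (count_space UNIV) (\<lambda>x. ennreal (pmf q x) * ennreal (pmf r x / pmf q x))"
    by (subst measure_pmf_eq_density) (simp add: density_density_eq)
  also have "(\<lambda>x. ennreal (pmf q x) * ennreal (pmf r x / pmf q x)) = (\<lambda>x. ennreal (pmf r x))"
  proof
    fix x
    show "ennreal (pmf q x) * ennreal (pmf r x / pmf q x) = ennreal (pmf r x)"
      using sub by (cases "x \<in> set_pmf q") (auto simp: set_pmf_iff simp flip: ennreal_mult)
  qed
  finally have "density (measure_pmf q) (\<lambda>x. ennreal (pmf r x / pmf q x)) = measure_pmf r"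
    by (simp flip: measure_pmf_eq_density)
  then have "AE x in measure_pmf q. ennreal (pmf r x / pmf q x) = RN_deriv (measure_pmf q) (measure_pmf r) x"
    by (intro measure_pmf.RN_deriv_unique) auto
  then have ae: "AE x in measure_pmf q.
      (enn2real (RN_deriv (measure_pmf q) (measure_pmf r) x))\<^sup>2 = (pmf r x / pmf q x)\<^sup>2"
    by (rule AE_mp) (auto simp: enn2real_ennreal intro!: AE_I2 dest!: sym[of "ennreal _"])
  show ?thesis
    unfolding chi2_dist_def by (subst integral_cong_AE[OF _ _ ae]) auto
qed

lemma chi2_dist_map_pmf:
  assumes sub: "set_pmf r \<subseteq> set_pmf q" and inj: "inj_on g (set_pmf q)"
  shows "chi2_dist (measure_pmf (map_pmf g q)) (measure_pmf (map_pmf g r)) =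
         chi2_dist (measure_pmf q) (measure_pmf r)"
proof -
  have r: "pmf (map_pmf g r) (g x) = pmf r x" if x: "x \<in> set_pmf q" for x
  proof (cases "x \<in> set_pmf r")
    case True
    then show ?thesis using inj_on_subset[OF inj sub] by (simp add: pmf_map_inj)
  next
    case False
    then have "g x \<notin> g ` set_pmf r" using inj sub x by (auto dest: inj_onD)
    then have "pmf (map_pmf g r) (g x) = 0" by (simp add: pmf_eq_0_set_pmf)
    then show ?thesis using False by (simp add: set_pmf_iff)
  qed
  have "measure_pmf.expectation q (\<lambda>x. (pmf (map_pmf g r) (g x) / pmf (map_pmf g q) (g x))\<^sup>2) =
        measure_pmf.expectation q (\<lambda>x. (pmf r x / pmf q x)\<^sup>2)"
    by (intro integral_cong_AE) (auto intro!: AE_pmfI simp: r pmf_map_inj[OF inj])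
  moreover have "set_pmf (map_pmf g r) \<subseteq> set_pmf (map_pmf g q)" using sub by auto
  ultimately show ?thesis using sub by (simp add: chi2_dist_pmf)
qed

lemma expectation_pmf_sum:
  fixes f :: "'a \<Rightarrow> real"
  assumes "finite (set_pmf p)"
  shows "measure_pmf.expectation p f = (\<Sum>x\<in>set_pmf p. pmf p x * f x)"
  using assms by (subst integral_measure_pmf[of "set_pmf p"]) auto

lemma expectation_swap_pmf:
  fixes f :: "'a \<Rightarrow> 'b \<Rightarrow> real"
  assumes "finite (set_pmf p)" "finite (set_pmf q)"
  shows "measure_pmf.expectation p (\<lambda>x. measure_pmf.expectation q (\<lambda>y. f x y)) =
         measure_pmf.expectation q (\<lambda>y. measure_pmf.expectation p (\<lambda>x. f x y))"
  using assms by (simp add: expectation_pmf_sum sum_distrib_left mult_ac) (rule sum.swap)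

lemma finite_set_Pi_pmf:
  assumes "finite A" "\<And>x. x \<in> A \<Longrightarrow> finite (set_pmf (p x))"
  shows "finite (set_pmf (Pi_pmf A dflt p))"
  using assms by (auto simp: set_Pi_pmf intro!: finite_PiE_dflt)

lemma expectation_Pi_pmf_split:
  fixes g :: "_ \<Rightarrow> real"
  assumes A: "finite A" "i \<in> A" and fin: "\<And>x. x \<in> A \<Longrightarrow> finite (set_pmf (p x))"
  shows "measure_pmf.expectation (Pi_pmf A dflt p) g =
         measure_pmf.expectation (Pi_pmf (A - {i}) dflt p)
           (\<lambda>f. measure_pmf.expectation (p i) (\<lambda>x. g (f(i := x))))"
proof -
  have A': "A = insert i (A - {i})" using A by auto
  have finR: "finite (set_pmf (Pi_pmf (A - {i}) dflt p))"
    using A fin by (intro finite_set_Pi_pmf) auto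
  have fini: "finite (set_pmf (p i))" using A fin by auto
  have "Pi_pmf A dflt p = p i \<bind> (\<lambda>x. map_pmf (\<lambda>f. f(i := x)) (Pi_pmf (A - {i}) dflt p))"
    by (subst A', subst Pi_pmf_insert') (use A in \<open>auto simp: map_pmf_def\<close>)
  then have "measure_pmf.expectation (Pi_pmf A dflt p) g =
     measure_pmf.expectation (p i) (\<lambda>x. measure_pmf.expectation (Pi_pmf (A - {i}) dflt p) (\<lambda>f. g (f(i := x))))"
    using finR fini by (simp add: pmf_expectation_bind[of "set_pmf (p i)"] expectation_pmf_sum[OF fini])
  also have "\<dots> = measure_pmf.expectation (Pi_pmf (A - {i}) dflt p)
           (\<lambda>f. measure_pmf.expectation (p i) (\<lambda>x. g (f(i := x))))"
    by (rule expectation_swap_pmf[OF fini finR])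
  finally show ?thesis .
qed

text \<open>
  Finite support makes every function integrable, so the factors may have either sign, as they do in
  moments of odd order.
\<close>
lemma expectation_prod_Pi_pmf_finite_support:
  fixes f :: "'a \<Rightarrow> 'b \<Rightarrow> real"
  assumes "finite A" "\<And>x. x \<in> A \<Longrightarrow> finite (set_pmf (p x))"
  shows "measure_pmf.expectation (Pi_pmf A dflt p) (\<lambda>y. \<Prod>x\<in>A. f x (y x)) =
         (\<Prod>x\<in>A. measure_pmf.expectation (p x) (f x))"
  using assms
proof (induction A rule: finite_induct)
  case (insert i A)
  have eq: "(\<Prod>x\<in>insert i A. f x ((h(i := z)) x)) = f i z * (\<Prod>x\<in>A. f x (h x))" for h z
    using insert.hyps by (auto intro!: prod.cong)
  have "measure_pmf.expectation (Pi_pmf (insert i A) dflt p) (\<lambda>y. \<Prod>x\<in>insert i A. f x (y x)) =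
     measure_pmf.expectation (Pi_pmf A dflt p)
       (\<lambda>h. measure_pmf.expectation (p i) (\<lambda>z. f i z * (\<Prod>x\<in>A. f x (h x))))"
    using insert by (subst expectation_Pi_pmf_split[of _ i]) (simp_all only: eq finite_insert insert_iff Diff_insert_absorb simp_thms)
  also have "\<dots> = (\<Prod>x\<in>insert i A. measure_pmf.expectation (p x) (f x))"
    using insert by simp
  finally show ?case .
qed simp

lemma bernoulli_ratio_product_mean:
  fixes p a b :: real
  assumes "0 < p" "p < 1" "a \<in> {0..1}" "b \<in> {0..1}"
  shows "measure_pmf.expectation (bernoulli_pmf p)
           (\<lambda>x. pmf (bernoulli_pmf a) x / pmf (bernoulli_pmf p) x * (pmf (bernoulli_pmf b) x / pmf (bernoulli_pmf p) x))
         = 1 + (a - p) * (b - p) / (p * (1 - p))"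
proof -
  define q where "q = 1 - p"
  have q: "q \<noteq> 0" "p \<noteq> 0" "p = 1 - q" using assms by (auto simp: q_def)
  have "a * b * q + (1 - a) * (1 - b) * p = p * q + (a - p) * (b - p)"
    unfolding q_def by (simp add: algebra_simps)
  then have "a * b / p + (1 - a) * (1 - b) / q = 1 + (a - p) * (b - p) / (p * q)"
    using q(1,2) by (simp add: field_simps)
  then show ?thesis using assms by (simp add: q_def)
qed

text \<open>
  The second-moment identity for mixtures. The likelihood ratio is an average over \<open>w\<close>, so its square
  is an average over two independent copies \<open>w\<close> and \<open>w'\<close>, and for fixed \<open>w\<close>, \<open>w'\<close> the expectation under
  the product measure \<open>q\<close> factorises over \<open>E\<close>.
\<close>
lemma chi2_dist_bernoulli_mixture:
  fixes W :: "'w pmf" and \<Omega> :: "'w \<Rightarrow> 'e \<Rightarrow> real" and p :: "'e \<Rightarrow> real"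
  assumes E: "finite E" and W: "finite (set_pmf W)"
    and p: "\<And>e. e \<in> E \<Longrightarrow> 0 < p e \<and> p e < 1"
    and \<Omega>: "\<And>w e. w \<in> set_pmf W \<Longrightarrow> e \<in> E \<Longrightarrow> \<Omega> w e \<in> {0..1}"
  defines "q \<equiv> Pi_pmf E False (\<lambda>e. bernoulli_pmf (p e))"
    and "r \<equiv> W \<bind> (\<lambda>w. Pi_pmf E False (\<lambda>e. bernoulli_pmf (\<Omega> w e)))"
  shows "set_pmf r \<subseteq> set_pmf q"
    and "chi2_dist (measure_pmf q) (measure_pmf r) =
         measure_pmf.expectation W (\<lambda>w. measure_pmf.expectation W (\<lambda>w'.
            \<Prod>e\<in>E. 1 + (\<Omega> w e - p e) * (\<Omega> w' e - p e) / (p e * (1 - p e)))) - 1"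
proof -
  have sq: "set_pmf q = PiE_dflt E False (\<lambda>_. UNIV)"
    unfolding q_def using E p by (auto simp: set_Pi_pmf PiE_dflt_def set_pmf_bernoulli)
  show sub: "set_pmf r \<subseteq> set_pmf q"
    unfolding sq r_def using E by (auto simp: set_Pi_pmf PiE_dflt_def)
  have finq: "finite (set_pmf q)" unfolding sq by (intro finite_PiE_dflt E) auto
  define R where "R w X = (\<Prod>e\<in>E. pmf (bernoulli_pmf (\<Omega> w e)) (X e) / pmf (bernoulli_pmf (p e)) (X e))" for w X
  have ratio: "pmf r X / pmf q X = measure_pmf.expectation W (\<lambda>w. R w X)" if "X \<in> set_pmf q" for X
  proof -
    have out: "\<And>e. e \<notin> E \<Longrightarrow> X e = False" using that by (auto simp: sq PiE_dflt_def)
    show ?thesis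
      unfolding r_def q_def pmf_bind R_def prod_dividef
      by (subst (1 2) pmf_Pi'[OF E out]) auto
  qed
  have "chi2_dist (measure_pmf q) (measure_pmf r) + 1 = measure_pmf.expectation q (\<lambda>X. (pmf r X / pmf q X)\<^sup>2)"
    by (simp add: chi2_dist_pmf[OF sub])
  also have "\<dots> = measure_pmf.expectation q (\<lambda>X. (measure_pmf.expectation W (\<lambda>w. R w X))\<^sup>2)"
    by (intro integral_cong_AE) (auto intro!: AE_pmfI simp: ratio)
  also have "\<dots> = measure_pmf.expectation q
      (\<lambda>X. measure_pmf.expectation W (\<lambda>w. measure_pmf.expectation W (\<lambda>w'. R w X * R w' X)))"
    by (simp add: power2_eq_square)
  also have "\<dots> = measure_pmf.expectation W (\<lambda>w. measure_pmf.expectation W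
      (\<lambda>w'. measure_pmf.expectation q (\<lambda>X. R w X * R w' X)))"
    by (subst expectation_swap_pmf[OF finq W], subst expectation_swap_pmf[OF finq W]) (rule refl)
  also have "\<dots> = measure_pmf.expectation W (\<lambda>w. measure_pmf.expectation W (\<lambda>w'.
            \<Prod>e\<in>E. 1 + (\<Omega> w e - p e) * (\<Omega> w' e - p e) / (p e * (1 - p e))))"
  proof -
    have "measure_pmf.expectation q (\<lambda>X. R w X * R w' X) =
       (\<Prod>e\<in>E. 1 + (\<Omega> w e - p e) * (\<Omega> w' e - p e) / (p e * (1 - p e)))"
      if "w \<in> set_pmf W" "w' \<in> set_pmf W" for w w'
      unfolding q_def R_def prod.distrib[symmetric]
      by (subst expectation_prod_Pi_pmf_finite_support[OF E])
         (use that p \<Omega> in \<open>simp, intro prod.cong refl bernoulli_ratio_product_mean, auto\<close>)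
    then show ?thesis
      by (simp add: expectation_pmf_sum[OF W] cong: sum.cong)
  qed
  finally show "chi2_dist (measure_pmf q) (measure_pmf r) =
         measure_pmf.expectation W (\<lambda>w. measure_pmf.expectation W (\<lambda>w'.
            \<Prod>e\<in>E. 1 + (\<Omega> w e - p e) * (\<Omega> w' e - p e) / (p e * (1 - p e)))) - 1"
    by simp
qed

text \<open>
  Since \<open>w\<close> and \<open>w'\<close> are independent with the same law, every term of the expansion over subsets of \<open>E\<close>
  becomes a square; for nonnegative \<open>a\<close> the sum therefore has nonnegative terms, and bounds on the
  individual means can be inserted.
\<close>
lemma expectation_prod_one_plus_subgraph_sum:
  fixes W :: "'w pmf" and m :: "'w \<Rightarrow> 'e \<Rightarrow> real"
  assumes E: "finite E" and W: "finite (set_pmf W)"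
  shows "measure_pmf.expectation W (\<lambda>w. measure_pmf.expectation W (\<lambda>w'. \<Prod>e\<in>E. 1 + a e * m w e * m w' e)) =
         (\<Sum>G\<in>Pow E. (\<Prod>e\<in>G. a e) * (measure_pmf.expectation W (\<lambda>w. \<Prod>e\<in>G. m w e))\<^sup>2)"
proof -
  have int: "integrable (measure_pmf W) f" for f :: "'w \<Rightarrow> real"
    using W by (rule integrable_measure_pmf_finite)
  have "(\<Prod>e\<in>E. 1 + a e * m w e * m w' e) =
        (\<Sum>G\<in>Pow E. (\<Prod>e\<in>G. a e) * ((\<Prod>e\<in>G. m w e) * (\<Prod>e\<in>G. m w' e)))" for w w'
    using prod_add[OF E, of "\<lambda>e. a e * m w e * m w' e" "\<lambda>_. 1"]
    by (simp add: add.commute prod.distrib mult_ac)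
  then show ?thesis
    by (simp add: int power2_eq_square Bochner_Integration.integral_sum mult_ac)
qed

section \<open>Subgraph means and degrees\<close>

lemma finite_upper_pairs [simp]: "finite (upper_pairs n)"
  by (rule finite_subset[of _ "{..<n} \<times> {..<n}"]) (auto simp: upper_pairs_def)

lemma upper_pairsD:
  assumes "e \<in> upper_pairs n"
  shows "fst e < n" "snd e < n" "fst e \<noteq> snd e"
  using assms by (auto simp: upper_pairs_def)

definition degree_in :: "(nat \<times> nat) set \<Rightarrow> nat \<Rightarrow> nat" where
  "degree_in G i = card {e \<in> G. fst e = i} + card {e \<in> G. snd e = i}"

lemma prod_edges_eq_prod_degrees:
  fixes y :: "nat \<Rightarrow> real"
  assumes G: "G \<subseteq> upper_pairs n"
  shows "(\<Prod>e\<in>G. y (fst e) * y (snd e)) = (\<Prod>i<n. y i ^ degree_in G i)"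
proof -
  have fin: "finite G" using finite_subset[OF G] by simp
  have one: "(\<Prod>e\<in>G. y (c e)) = (\<Prod>i<n. y i ^ card {e \<in> G. c e = i})" if "c ` G \<subseteq> {..<n}" for c
  proof -
    have "(\<Prod>e\<in>G. y (c e)) = (\<Prod>i<n. \<Prod>e\<in>{e \<in> G. c e = i}. y (c e))"
      using that fin by (subst prod.group) auto
    also have "\<dots> = (\<Prod>i<n. y i ^ card {e \<in> G. c e = i})" by (intro prod.cong) auto
    finally show ?thesis .
  qed
  show ?thesis
    using G by (subst prod.distrib, subst (1 2) one)
      (auto simp: degree_in_def power_add prod.distrib dest: upper_pairsD)
qed

text \<open>
  If the vertex \<open>i\<close> lies on exactly one edge of \<open>G\<close>, then given all other labels the product depends on
  the label of \<open>i\<close> through a single factor, whose conditional mean is zero.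
\<close>
lemma expectation_subgraph_leaf_eq_0:
  fixes m :: "'a \<Rightarrow> 'a \<Rightarrow> real"
  assumes F: "finite (set_pmf F)"
    and m0: "\<And>y. y \<in> set_pmf F \<Longrightarrow> measure_pmf.expectation F (\<lambda>x. m x y) = 0"
            "\<And>y. y \<in> set_pmf F \<Longrightarrow> measure_pmf.expectation F (\<lambda>x. m y x) = 0"
    and G: "G \<subseteq> upper_pairs n" and i: "i < n" and leaf: "degree_in G i = 1"
  shows "measure_pmf.expectation (Pi_pmf {..<n} z (\<lambda>_. F)) (\<lambda>\<pi>. \<Prod>e\<in>G. m (\<pi> (fst e)) (\<pi> (snd e))) = 0"
proof -
  have fin: "finite G" using finite_subset[OF G] by simp
  obtain e where e: "e \<in> G" "fst e = i \<or> snd e = i"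
    and other: "\<And>e'. e' \<in> G - {e} \<Longrightarrow> fst e' \<noteq> i \<and> snd e' \<noteq> i"
  proof -
    have "(card {e \<in> G. fst e = i} = 1 \<and> card {e \<in> G. snd e = i} = 0) \<or>
          (card {e \<in> G. fst e = i} = 0 \<and> card {e \<in> G. snd e = i} = 1)"
      using leaf by (auto simp: degree_in_def add_is_1)
    then obtain e where "({e \<in> G. fst e = i} = {e} \<and> {e \<in> G. snd e = i} = {}) \<or>
          ({e \<in> G. fst e = i} = {} \<and> {e \<in> G. snd e = i} = {e})"
      using fin by (auto simp: card_1_singleton_iff)
    then show ?thesis by (intro that[of e]) blast+
  qed
  have zero: "measure_pmf.expectation F (\<lambda>x. \<Prod>e\<in>G. m ((f(i := x)) (fst e)) ((f(i := x)) (snd e))) = 0"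
    if f: "f \<in> set_pmf (Pi_pmf ({..<n} - {i}) z (\<lambda>_. F))" for f
  proof -
    define C where "C = (\<Prod>e\<in>G - {e}. m (f (fst e)) (f (snd e)))"
    have fF: "f j \<in> set_pmf F" if "j < n" "j \<noteq> i" for j
      using f that by (auto simp: set_Pi_pmf PiE_dflt_def)
    have "(\<Prod>e\<in>G. m ((f(i := x)) (fst e)) ((f(i := x)) (snd e))) =
            m ((f(i := x)) (fst e)) ((f(i := x)) (snd e)) * C" for x
      unfolding C_def using fin e(1) other by (subst prod.remove[of _ e]) (auto intro!: prod.cong)
    then have "measure_pmf.expectation F (\<lambda>x. \<Prod>e\<in>G. m ((f(i := x)) (fst e)) ((f(i := x)) (snd e))) =
       measure_pmf.expectation F (\<lambda>x. m ((f(i := x)) (fst e)) ((f(i := x)) (snd e))) * C"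
      by (simp del: fun_upd_apply)
    also have "measure_pmf.expectation F (\<lambda>x. m ((f(i := x)) (fst e)) ((f(i := x)) (snd e))) = 0"
      using e G upper_pairsD[of e n] by (auto simp: m0 fF)
    finally show ?thesis by simp
  qed
  have "measure_pmf.expectation (Pi_pmf {..<n} z (\<lambda>_. F)) (\<lambda>\<pi>. \<Prod>e\<in>G. m (\<pi> (fst e)) (\<pi> (snd e))) =
    measure_pmf.expectation (Pi_pmf ({..<n} - {i}) z (\<lambda>_. F))
      (\<lambda>f. measure_pmf.expectation F (\<lambda>x. \<Prod>e\<in>G. m ((f(i := x)) (fst e)) ((f(i := x)) (snd e))))"
    using i F by (intro expectation_Pi_pmf_split) auto
  also have "\<dots> = measure_pmf.expectation (Pi_pmf ({..<n} - {i}) z (\<lambda>_. F)) (\<lambda>_. 0)"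
    by (intro integral_cong_AE) (auto intro!: AE_pmfI simp: zero simp del: fun_upd_apply)
  finally show ?thesis by simp
qed

text \<open>
  A centred two-point law all of whose other moments are at least 1, odd orders included. A symmetric
  sign has vanishing third moment and would not dominate subgraphs with vertices of degree 3.
\<close>
definition skew_sign :: "real pmf" where
  "skew_sign = map_pmf (\<lambda>b. if b then 2 else - 1) (bernoulli_pmf (1 / 3))"

lemma expectation_skew_sign: "measure_pmf.expectation skew_sign f = (f 2 + 2 * f (- 1)) / (3::real)"
  by (simp add: skew_sign_def)

lemma set_skew_sign: "set_pmf skew_sign = {2, - 1}"
  by (auto simp: skew_sign_def set_pmf_bernoulli image_iff)

lemma skew_sign_moment_1: "measure_pmf.expectation skew_sign (\<lambda>x. x) = 0"
  by (simp add: expectation_skew_sign)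

lemma skew_sign_moment_ge_1:
  assumes "k \<noteq> 1"
  shows "measure_pmf.expectation skew_sign (\<lambda>x. x ^ k) \<ge> 1"
proof (cases "k = 0")
  case False
  then have "(3::real) \<le> 2 ^ k + 2 * (- 1) ^ k"
  proof (cases "even k")
    case True
    then show ?thesis using one_le_power[of "2::real" k] by simp
  next
    case odd: False
    then have "k \<ge> 3" using assms by (cases k; cases "k - 1"; cases "k - 2") auto
    then have "(2::real) ^ 3 \<le> 2 ^ k" by (intro power_increasing) auto
    then show ?thesis using odd by simp
  qed
  then show ?thesis by (simp add: expectation_skew_sign)
qed simp

lemma skew_sign_moment_nonneg: "measure_pmf.expectation skew_sign (\<lambda>x. x ^ k) \<ge> 0"
  using skew_sign_moment_1 skew_sign_moment_ge_1[of k] by (cases "k = 1") auto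

text \<open>
  Comparison of an arbitrary centred kernel with a product of scalar variables. If \<open>G\<close> has a leaf, the
  left side vanishes; if not, every moment occurring on the right is at least 1, and the left side is
  at most \<open>\<epsilon> ^ card G\<close> for trivial reasons. The right side no longer depends on the label space.
\<close>
lemma subgraph_mean_square_le_skew_sign:
  fixes m :: "'a \<Rightarrow> 'a \<Rightarrow> real"
  assumes F: "finite (set_pmf F)"
    and m0: "\<And>y. y \<in> set_pmf F \<Longrightarrow> measure_pmf.expectation F (\<lambda>x. m x y) = 0"
            "\<And>y. y \<in> set_pmf F \<Longrightarrow> measure_pmf.expectation F (\<lambda>x. m y x) = 0"
    and me: "\<And>x y. x \<in> set_pmf F \<Longrightarrow> y \<in> set_pmf F \<Longrightarrow> (m x y)\<^sup>2 \<le> \<epsilon>"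
    and G: "G \<subseteq> upper_pairs n"
  shows "(measure_pmf.expectation (Pi_pmf {..<n} z (\<lambda>_. F)) (\<lambda>\<pi>. \<Prod>e\<in>G. m (\<pi> (fst e)) (\<pi> (snd e))))\<^sup>2
    \<le> \<epsilon> ^ card G * measure_pmf.expectation (Pi_pmf {..<n} 0 (\<lambda>_. skew_sign)) (\<lambda>y. \<Prod>e\<in>G. y (fst e) * y (snd e))"
    (is "?L\<^sup>2 \<le> _ * ?R")
proof -
  let ?\<Pi> = "Pi_pmf {..<n} z (\<lambda>_. F)"
  obtain x0 where "x0 \<in> set_pmf F" using set_pmf_not_empty by fast
  then have \<epsilon>: "\<epsilon> \<ge> 0" using me[of x0 x0] by (meson order_trans zero_le_power2)
  have R: "?R = (\<Prod>i<n. measure_pmf.expectation skew_sign (\<lambda>x. x ^ degree_in G i))"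
    unfolding prod_edges_eq_prod_degrees[OF G]
    by (subst expectation_prod_Pi_pmf_finite_support) (auto simp: set_skew_sign)
  show ?thesis
  proof (cases "\<exists>i<n. degree_in G i = 1")
    case True
    then obtain i where "i < n" "degree_in G i = 1" by blast
    then have "?L = 0" by (intro expectation_subgraph_leaf_eq_0[OF F m0 G])
    moreover have "?R \<ge> 0" unfolding R by (intro prod_nonneg ballI skew_sign_moment_nonneg)
    ultimately show ?thesis using \<epsilon> by simp
  next
    case False
    then have R1: "1 \<le> ?R" unfolding R by (intro prod_ge_1 skew_sign_moment_ge_1) auto
    have ptw: "\<bar>\<Prod>e\<in>G. m (\<pi> (fst e)) (\<pi> (snd e))\<bar> \<le> sqrt \<epsilon> ^ card G" if "\<pi> \<in> set_pmf ?\<Pi>" for \<pi>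
    proof -
      have "\<bar>\<Prod>e\<in>G. m (\<pi> (fst e)) (\<pi> (snd e))\<bar> \<le> (\<Prod>e\<in>G. sqrt \<epsilon>)"
        unfolding abs_prod
      proof (intro prod_mono conjI)
        fix e assume "e \<in> G"
        then have "\<pi> (fst e) \<in> set_pmf F" "\<pi> (snd e) \<in> set_pmf F"
          using that G upper_pairsD[of e n] by (auto simp: set_Pi_pmf PiE_dflt_def)
        then show "\<bar>m (\<pi> (fst e)) (\<pi> (snd e))\<bar> \<le> sqrt \<epsilon>" by (intro real_le_rsqrt) (simp add: me)
      qed auto
      then show ?thesis by simp
    qed
    have fin: "finite (set_pmf ?\<Pi>)" using F by (intro finite_set_Pi_pmf) auto
    have "\<bar>?L\<bar> \<le> measure_pmf.expectation ?\<Pi> (\<lambda>\<pi>. \<bar>\<Prod>e\<in>G. m (\<pi> (fst e)) (\<pi> (snd e))\<bar>)"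
      by (rule integral_abs_bound)
    also have "\<dots> \<le> measure_pmf.expectation ?\<Pi> (\<lambda>_. sqrt \<epsilon> ^ card G)"
      using fin ptw by (intro integral_mono_AE integrable_measure_pmf_finite AE_pmfI) auto
    finally have "\<bar>?L\<bar>\<^sup>2 \<le> (sqrt \<epsilon> ^ card G)\<^sup>2" by (intro power_mono) auto
    also have "\<dots> = ((sqrt \<epsilon>)\<^sup>2) ^ card G" by (simp add: mult.commute flip: power_mult)
    also have "\<dots> = \<epsilon> ^ card G * 1" using \<epsilon> by simp
    also have "\<dots> \<le> \<epsilon> ^ card G * ?R" using \<epsilon> R1 by (intro mult_left_mono) auto
    finally show ?thesis by simp
  qed
qed

section \<open>Exponential moments of a quadratic form\<close>

text \<open>
  Hoeffding's lemma for a variable with values in an interval of length 3. The underlying scalar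
  inequality covers nonnegative exponents only; for \<open>t < 0\<close> it is applied to the reflected variable, that
  is with weight \<open>2 / 3\<close> in place of \<open>1 / 3\<close>.
\<close>
lemma skew_sign_mgf_le: "measure_pmf.expectation skew_sign (\<lambda>x. exp (t * x)) \<le> exp (9 / 8 * t\<^sup>2)"
proof -
  have aux: "exp (- (h * p) + ln (1 + p * (exp h - 1))) \<le> exp (h\<^sup>2 / 8)" if "h \<ge> 0" "p \<ge> 0" for h p :: real
    using Hoeffdings_lemma_aux[OF that] by simp
  show ?thesis
  proof (cases "t \<ge> 0")
    case True
    have p: "1 + 1 / 3 * (exp (3 * t) - 1) > 0" by (simp add: field_simps add_pos_pos)
    have "exp (- (3 * t * (1 / 3)) + ln (1 + 1 / 3 * (exp (3 * t) - 1))) = exp (- t) * (1 + 1 / 3 * (exp (3 * t) - 1))"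
      using p by (subst exp_add) (simp add: exp_ln)
    also have "\<dots> = (exp (t * 2) + 2 * exp (t * (- 1))) / 3"
      by (simp add: field_simps flip: exp_add)
    finally have eq: "exp (- (3 * t * (1 / 3)) + ln (1 + 1 / 3 * (exp (3 * t) - 1))) = (exp (t * 2) + 2 * exp (t * (- 1))) / 3" .
    have "(exp (t * 2) + 2 * exp (t * (- 1))) / 3 \<le> exp ((3 * t)\<^sup>2 / 8)"
      unfolding eq[symmetric] by (rule aux) (use True in auto)
    then show ?thesis by (simp add: expectation_skew_sign power_mult_distrib)
  next
    case False
    have p: "1 + 2 / 3 * (exp (- 3 * t) - 1) > 0" by (simp add: field_simps add_pos_pos)
    have "exp (- (- 3 * t * (2 / 3)) + ln (1 + 2 / 3 * (exp (- 3 * t) - 1))) = exp (2 * t) * (1 + 2 / 3 * (exp (- 3 * t) - 1))"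
      using p by (subst exp_add) (simp add: exp_ln)
    also have "\<dots> = (exp (t * 2) + 2 * exp (t * (- 1))) / 3"
      by (simp add: field_simps flip: exp_add)
    finally have eq: "exp (- (- 3 * t * (2 / 3)) + ln (1 + 2 / 3 * (exp (- 3 * t) - 1))) = (exp (t * 2) + 2 * exp (t * (- 1))) / 3" .
    have "(exp (t * 2) + 2 * exp (t * (- 1))) / 3 \<le> exp ((- 3 * t)\<^sup>2 / 8)"
      unfolding eq[symmetric] by (rule aux) (use False in auto)
    then show ?thesis by (simp add: expectation_skew_sign power_mult_distrib)
  qed
qed

lemma has_bochner_integral_gaussian_linear:
  "has_bochner_integral lborel (\<lambda>x. exp (x * w) * std_normal_density x) (exp (w\<^sup>2 / 2))"
proof -
  have "exp (x * w) * std_normal_density x = exp (w\<^sup>2 / 2) * normal_density w 1 x" for x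
  proof -
    have "x * w + - x\<^sup>2 / 2 = w\<^sup>2 / 2 + - (x - w)\<^sup>2 / 2" by (simp add: power2_eq_square field_simps)
    then have "exp (x * w) * exp (- x\<^sup>2 / 2) = exp (w\<^sup>2 / 2) * exp (- (x - w)\<^sup>2 / 2)"
      unfolding exp_add[symmetric] by simp
    then show ?thesis by (simp add: normal_density_def)
  qed
  moreover have "has_bochner_integral lborel (\<lambda>x. exp (w\<^sup>2 / 2) * normal_density w 1 x) (exp (w\<^sup>2 / 2) * 1)"
    by (intro has_bochner_integral_mult_right) (simp add: has_bochner_integral_iff)
  ultimately show ?thesis by simp
qed

lemma has_bochner_integral_gaussian_quadratic:
  assumes "c < 1 / 2"
  shows "has_bochner_integral lborel (\<lambda>x. exp (c * x\<^sup>2) * std_normal_density x) (1 / sqrt (1 - 2 * c))"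
proof -
  define \<sigma> where "\<sigma> = 1 / sqrt (1 - 2 * c)"
  have s: "\<sigma> > 0" "\<sigma>\<^sup>2 = 1 / (1 - 2 * c)" using assms by (auto simp: \<sigma>_def power_divide)
  have "exp (c * x\<^sup>2) * std_normal_density x = \<sigma> * normal_density 0 \<sigma> x" for x
  proof -
    have "c * x\<^sup>2 + - x\<^sup>2 / 2 = - x\<^sup>2 / (2 * \<sigma>\<^sup>2)" using assms by (simp add: s(2) field_simps)
    then have "exp (c * x\<^sup>2) * exp (- x\<^sup>2 / 2) = exp (- x\<^sup>2 / (2 * \<sigma>\<^sup>2))"
      unfolding exp_add[symmetric] by simp
    then show ?thesis using s(1) by (simp add: normal_density_def real_sqrt_mult)
  qed
  moreover have "has_bochner_integral lborel (\<lambda>x. \<sigma> * normal_density 0 \<sigma> x) (\<sigma> * 1)"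
    using s(1) by (intro has_bochner_integral_mult_right) (simp add: has_bochner_integral_iff)
  ultimately show ?thesis by (simp add: \<sigma>_def)
qed

text \<open>
  From \<open>1 + x \<le> exp x\<close> the product is at most \<open>exp (W\<^sup>2 / 2)\<close> with the linear form
  \<open>W y = (\<Sum>i<n. b i * y i)\<close>. The square in the exponent is linearised by a standard Gaussian variable \<open>x\<close>:
  \<open>exp (W\<^sup>2 / 2)\<close> is the mean of \<open>exp (x * W)\<close>. For fixed \<open>x\<close> the mean over \<open>y\<close> factorises and is at most
  \<open>exp (9 / 8 * s * x\<^sup>2)\<close> where \<open>s = (\<Sum>i<n. (b i)\<^sup>2)\<close>, and the Gaussian mean of that is explicit.
  Smallness of \<open>s\<close> also keeps all factors \<open>1 + x\<close> nonnegative, so that they can be multiplied.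
\<close>
lemma skew_sign_chaos_le:
  fixes b :: "nat \<Rightarrow> real"
  assumes b: "\<And>i. i < n \<Longrightarrow> b i \<ge> 0" and small: "(\<Sum>i<n. (b i)\<^sup>2) \<le> 1 / 4"
  shows "measure_pmf.expectation (Pi_pmf {..<n} 0 (\<lambda>_. skew_sign))
           (\<lambda>y. \<Prod>e\<in>upper_pairs n. 1 + b (fst e) * b (snd e) * (y (fst e) * y (snd e)))
         \<le> 1 / sqrt (1 - 9 / 4 * (\<Sum>i<n. (b i)\<^sup>2))"
proof -
  let ?Y = "Pi_pmf {..<n} 0 (\<lambda>_. skew_sign)"
  define s where "s = (\<Sum>i<n. (b i)\<^sup>2)"
  define W where "W y = (\<Sum>i<n. b i * y i)" for y :: "nat \<Rightarrow> real"
  have fin: "finite (set_pmf ?Y)" by (intro finite_set_Pi_pmf) (auto simp: set_skew_sign)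
  have ptw: "(\<Prod>e\<in>upper_pairs n. 1 + b (fst e) * b (snd e) * (y (fst e) * y (snd e))) \<le> exp ((W y)\<^sup>2 / 2)"
    if y: "y \<in> set_pmf ?Y" for y
  proof -
    have y2: "\<bar>y i\<bar> \<le> 2" if "i < n" for i
    proof -
      have "y i \<in> {2, -1}" using y that by (auto simp: set_Pi_pmf PiE_dflt_def set_skew_sign)
      then show ?thesis by auto
    qed
    \<comment> \<open>By the arithmetic-geometric mean \<open>b i * b j \<le> s / 2 \<le> 1 / 8\<close>, while \<open>\<bar>y i * y j\<bar> \<le> 4\<close>.\<close>
    have factor: "0 \<le> 1 + b (fst e) * b (snd e) * (y (fst e) * y (snd e))" if e: "e \<in> upper_pairs n" for e
    proof -
      note n = upper_pairsD[OF e]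
      have "2 * (b (fst e) * b (snd e)) \<le> (b (fst e))\<^sup>2 + (b (snd e))\<^sup>2"
        using zero_le_power2[of "b (fst e) - b (snd e)"] by (simp add: power2_eq_square algebra_simps)
      also have "\<dots> = (\<Sum>i\<in>{fst e, snd e}. (b i)\<^sup>2)" using n by simp
      also have "\<dots> \<le> s" unfolding s_def using n by (intro sum_mono2) auto
      finally have bb: "b (fst e) * b (snd e) \<le> 1 / 8" using small by (simp add: s_def)
      have yy: "\<bar>y (fst e) * y (snd e)\<bar> \<le> 2 * 2"
        unfolding abs_mult using n by (intro mult_mono y2) auto
      have "\<bar>b (fst e) * b (snd e) * (y (fst e) * y (snd e))\<bar> \<le> 1 / 8 * (2 * 2)"
        unfolding abs_mult[of "b (fst e) * b (snd e)"]
        using n b bb yy by (intro mult_mono) auto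
      then show ?thesis by linarith
    qed
    have "(\<Prod>e\<in>upper_pairs n. 1 + b (fst e) * b (snd e) * (y (fst e) * y (snd e)))
       \<le> (\<Prod>e\<in>upper_pairs n. exp (b (fst e) * b (snd e) * (y (fst e) * y (snd e))))"
      using factor by (intro prod_mono conjI exp_ge_add_one_self)
    also have "\<dots> = exp (\<Sum>e\<in>upper_pairs n. b (fst e) * b (snd e) * (y (fst e) * y (snd e)))"
      by (simp add: exp_sum)
    also have "\<dots> \<le> exp ((W y)\<^sup>2 / 2)"
    proof -
      define u where "u i = b i * y i" for i
      have "(W y)\<^sup>2 = (\<Sum>(i, j)\<in>{..<n} \<times> {..<n}. u i * u j)"
        unfolding W_def u_def power2_eq_square sum_product by (simp add: sum.cartesian_product)
      also have "\<dots> = (\<Sum>(i, j)\<in>upper_pairs n \<union> prod.swap ` upper_pairs n \<union> (\<lambda>i. (i, i)) ` {..<n}. u i * u j)"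
        by (rule sum.cong) (auto simp: upper_pairs_def image_iff)
      also have "\<dots> = (\<Sum>(i, j)\<in>upper_pairs n. u i * u j) + (\<Sum>(i, j)\<in>prod.swap ` upper_pairs n. u i * u j)
            + (\<Sum>(i, j)\<in>(\<lambda>i. (i, i)) ` {..<n}. u i * u j)"
      proof -
        have "upper_pairs n \<inter> prod.swap ` upper_pairs n = {}"
          "(upper_pairs n \<union> prod.swap ` upper_pairs n) \<inter> (\<lambda>i. (i, i)) ` {..<n} = {}"
          by (auto simp: upper_pairs_def)
        then show ?thesis by (simp add: sum.union_disjoint)
      qed
      also have "(\<Sum>(i, j)\<in>prod.swap ` upper_pairs n. u i * u j) = (\<Sum>(i, j)\<in>upper_pairs n. u i * u j)"
        by (subst sum.reindex) (auto simp: case_prod_beta' mult.commute)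
      also have "(\<Sum>(i, j)\<in>(\<lambda>i. (i, i)) ` {..<n}. u i * u j) = (\<Sum>i<n. u i * u i)"
        by (subst sum.reindex) (auto simp: inj_on_def)
      finally have "(W y)\<^sup>2 = 2 * (\<Sum>(i, j)\<in>upper_pairs n. u i * u j) + (\<Sum>i<n. u i * u i)" by simp
      moreover have "(\<Sum>i<n. u i * u i) \<ge> 0" by (intro sum_nonneg) auto
      moreover have "(\<Sum>(i, j)\<in>upper_pairs n. u i * u j) =
          (\<Sum>e\<in>upper_pairs n. b (fst e) * b (snd e) * (y (fst e) * y (snd e)))"
        by (intro sum.cong) (auto simp: u_def)
      ultimately show ?thesis by simp
    qed
    finally show ?thesis .
  qed
  have "measure_pmf.expectation ?Y (\<lambda>y. \<Prod>e\<in>upper_pairs n. 1 + b (fst e) * b (snd e) * (y (fst e) * y (snd e)))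
     \<le> measure_pmf.expectation ?Y (\<lambda>y. exp ((W y)\<^sup>2 / 2))"
    using fin ptw by (intro integral_mono_AE integrable_measure_pmf_finite AE_pmfI) auto
  also have "\<dots> \<le> 1 / sqrt (1 - 2 * (9 / 8 * s))"
  proof -
    have lower: "has_bochner_integral lborel
        (\<lambda>x. \<Sum>y\<in>set_pmf ?Y. pmf ?Y y * (exp (x * W y) * std_normal_density x))
        (measure_pmf.expectation ?Y (\<lambda>y. exp ((W y)\<^sup>2 / 2)))"
      unfolding expectation_pmf_sum[OF fin]
      by (intro has_bochner_integral_sum has_bochner_integral_mult_right has_bochner_integral_gaussian_linear)
    have upper: "has_bochner_integral lborel (\<lambda>x. exp (9 / 8 * s * x\<^sup>2) * std_normal_density x) (1 / sqrt (1 - 2 * (9 / 8 * s)))"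
      using small by (intro has_bochner_integral_gaussian_quadratic) (simp add: s_def)
    have mgf: "(\<Sum>y\<in>set_pmf ?Y. pmf ?Y y * (exp (x * W y) * std_normal_density x))
       \<le> exp (9 / 8 * s * x\<^sup>2) * std_normal_density x" for x
    proof -
      have "measure_pmf.expectation ?Y (\<lambda>y. exp (x * W y)) = measure_pmf.expectation ?Y (\<lambda>y. \<Prod>i<n. exp (x * b i * y i))"
        by (simp add: W_def sum_distrib_left exp_sum mult_ac)
      also have "\<dots> = (\<Prod>i<n. measure_pmf.expectation skew_sign (\<lambda>v. exp (x * b i * v)))"
        by (intro expectation_prod_Pi_pmf_finite_support) (auto simp: set_skew_sign)
      also have "\<dots> \<le> (\<Prod>i<n. exp (9 / 8 * (x * b i)\<^sup>2))"
        by (intro prod_mono conjI skew_sign_mgf_le integral_nonneg) auto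
      also have "\<dots> = exp (9 / 8 * s * x\<^sup>2)"
        by (simp add: s_def sum_distrib_left sum_distrib_right power_mult_distrib mult_ac flip: exp_sum)
      finally have "measure_pmf.expectation ?Y (\<lambda>y. exp (x * W y)) * std_normal_density x
         \<le> exp (9 / 8 * s * x\<^sup>2) * std_normal_density x"
        by (intro mult_right_mono) auto
      then show ?thesis
        unfolding expectation_pmf_sum[OF fin] by (simp add: sum_distrib_right mult.assoc)
    qed
    show ?thesis
      using integral_mono[OF integrable.intros[OF lower] integrable.intros[OF upper] mgf]
      by (simp only: has_bochner_integral_integral_eq[OF lower] has_bochner_integral_integral_eq[OF upper])
  qed
  finally show ?thesis by (simp add: s_def)
qed

section \<open>Chi-square distance in the block model\<close>

lemma inj_on_adj_of_upper:
  "inj_on (adj_of_upper n) {X. \<forall>e. e \<notin> upper_pairs n \<longrightarrow> X e = False}"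
proof (rule inj_onI, rule ext)
  fix X Y e
  assume X: "X \<in> {X. \<forall>e. e \<notin> upper_pairs n \<longrightarrow> X e = False}"
    and Y: "Y \<in> {X. \<forall>e. e \<notin> upper_pairs n \<longrightarrow> X e = False}"
    and eq: "adj_of_upper n X = adj_of_upper n Y"
  show "X e = Y e"
  proof (cases "e \<in> upper_pairs n")
    case True
    then have "(snd e, fst e) \<notin> upper_pairs n" by (auto simp: upper_pairs_def)
    then show ?thesis
      using fun_cong[OF fun_cong[OF eq, of "fst e"], of "snd e"] True
      by (simp add: adj_of_upper_def of_bool_eq_iff)
  next
    case False
    then show ?thesis using X Y by blast
  qed
qed

text \<open>
  The empty subgraph contributes exactly 1 to
  \<open>\<Delta> + 1\<close> and all other terms are nonnegative, whence the lower bound. For the upper bound each squared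
  mean is replaced by a mean over skew signs, and the expansion over subgraphs is folded back into a
  product.
\<close>
lemma chi2_centred_kernel_bounds:
  fixes F :: "'a pmf" and z :: 'a and m :: "'a \<Rightarrow> 'a \<Rightarrow> real" and \<theta> :: "nat \<Rightarrow> real"
  assumes F: "finite (set_pmf F)"
    and \<theta>: "\<And>i. i < n \<Longrightarrow> 0 < \<theta> i \<and> \<theta> i \<le> c" and c: "c < 1"
    and m0: "\<And>y. y \<in> set_pmf F \<Longrightarrow> measure_pmf.expectation F (\<lambda>x. m x y) = 0"
            "\<And>y. y \<in> set_pmf F \<Longrightarrow> measure_pmf.expectation F (\<lambda>x. m y x) = 0"
    and me: "\<And>x y. x \<in> set_pmf F \<Longrightarrow> y \<in> set_pmf F \<Longrightarrow> (m x y)\<^sup>2 \<le> \<epsilon>"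
    and prob: "\<And>\<pi> i j. (\<And>k. k < n \<Longrightarrow> \<pi> k \<in> set_pmf F) \<Longrightarrow> i < j \<Longrightarrow> j < n \<Longrightarrow>
         \<theta> i * \<theta> j * (1 + m (\<pi> i) (\<pi> j)) \<in> {0..1}"
    and small: "\<epsilon> / (1 - c\<^sup>2) * (\<Sum>i<n. (\<theta> i)\<^sup>2) \<le> 1 / 4"
  defines "\<Delta> \<equiv> chi2_dist (measure_pmf (null_law n \<theta>))
     (measure_pmf (Pi_pmf {..<n} z (\<lambda>_. F) \<bind> (\<lambda>\<pi>. adj_law n (\<lambda>i j. \<theta> i * \<theta> j * (1 + m (\<pi> i) (\<pi> j))))))"
  shows "0 \<le> \<Delta>" and "\<Delta> \<le> 1 / sqrt (1 - 9 / 4 * (\<epsilon> / (1 - c\<^sup>2) * (\<Sum>i<n. (\<theta> i)\<^sup>2))) - 1"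
proof -
  let ?W = "Pi_pmf {..<n} z (\<lambda>_. F)" and ?E = "upper_pairs n"
  define p where "p e = \<theta> (fst e) * \<theta> (snd e)" for e :: "nat \<times> nat"
  define M where "M \<pi> e = m (\<pi> (fst e)) (\<pi> (snd e))" for \<pi> and e :: "nat \<times> nat"
  define a where "a e = p e / (1 - p e)" for e
  have W: "finite (set_pmf ?W)" using F by (intro finite_set_Pi_pmf) auto
  have p: "0 < p e" "p e < 1" "p e \<le> c\<^sup>2" "c\<^sup>2 < 1" if e: "e \<in> ?E" for e
  proof -
    note n = upper_pairsD[OF e]
    show "0 < p e" using \<theta> n by (simp add: p_def)
    have c0: "0 < c" using \<theta>[OF n(1)] by linarith
    show le: "p e \<le> c\<^sup>2"
      unfolding p_def power2_eq_square using \<theta> n c0 by (intro mult_mono) (auto simp: less_imp_le)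
    show "c\<^sup>2 < 1" using c c0 by (simp add: power_less_one_iff abs_square_less_1)
    then show "p e < 1" using le by linarith
  qed
  have \<Omega>: "p e * (1 + M \<pi> e) \<in> {0..1}" if "\<pi> \<in> set_pmf ?W" "e \<in> ?E" for \<pi> e
    unfolding p_def M_def using that
    by (intro prob) (auto simp: set_Pi_pmf PiE_dflt_def upper_pairs_def)
  define q where "q = Pi_pmf ?E False (\<lambda>e. bernoulli_pmf (p e))"
  define r where "r = ?W \<bind> (\<lambda>\<pi>. Pi_pmf ?E False (\<lambda>e. bernoulli_pmf (p e * (1 + M \<pi> e))))"
  have null: "null_law n \<theta> = map_pmf (adj_of_upper n) q"
    by (simp add: null_law_def adj_law_def q_def p_def omega_null_def case_prod_beta')
  have alt: "?W \<bind> (\<lambda>\<pi>. adj_law n (\<lambda>i j. \<theta> i * \<theta> j * (1 + m (\<pi> i) (\<pi> j)))) = map_pmf (adj_of_upper n) r"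
    by (simp add: adj_law_def r_def p_def M_def case_prod_beta' map_bind_pmf)
  have "\<Delta> = chi2_dist (measure_pmf q) (measure_pmf r)"
  proof -
    have "inj_on (adj_of_upper n) (set_pmf q)"
      unfolding q_def by (rule inj_on_subset[OF inj_on_adj_of_upper]) (intro set_Pi_pmf_subset finite_upper_pairs)
    moreover have "set_pmf r \<subseteq> set_pmf q"
      unfolding q_def r_def using p \<Omega> by (intro chi2_dist_bernoulli_mixture(1)[OF _ W]) auto
    ultimately show ?thesis unfolding \<Delta>_def null alt by (intro chi2_dist_map_pmf)
  qed
  also have "\<dots> + 1 = measure_pmf.expectation ?W (\<lambda>w. measure_pmf.expectation ?W (\<lambda>w'.
            \<Prod>e\<in>?E. 1 + (p e * (1 + M w e) - p e) * (p e * (1 + M w' e) - p e) / (p e * (1 - p e))))"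
    unfolding q_def r_def using p \<Omega> by (subst chi2_dist_bernoulli_mixture(2)[OF _ W]) auto
  also have "\<dots> = measure_pmf.expectation ?W (\<lambda>w. measure_pmf.expectation ?W (\<lambda>w'.
            \<Prod>e\<in>?E. 1 + a e * M w e * M w' e))"
  proof -
    have "(p e * (1 + x) - p e) * (p e * (1 + y) - p e) / (p e * (1 - p e)) = a e * x * y"
      if "e \<in> ?E" for e x y
      using p[OF that] by (simp add: a_def field_simps)
    then show ?thesis by (simp cong: prod.cong)
  qed
  also have "\<dots> = (\<Sum>G\<in>Pow ?E. (\<Prod>e\<in>G. a e) * (measure_pmf.expectation ?W (\<lambda>w. \<Prod>e\<in>G. M w e))\<^sup>2)"
    by (rule expectation_prod_one_plus_subgraph_sum[OF finite_upper_pairs W])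
  finally have chi: "\<Delta> + 1 = (\<Sum>G\<in>Pow ?E. (\<Prod>e\<in>G. a e) * (measure_pmf.expectation ?W (\<lambda>w. \<Prod>e\<in>G. M w e))\<^sup>2)" .
  have a0: "0 \<le> a e" if "e \<in> ?E" for e using p[OF that] by (simp add: a_def)
  \<comment> \<open>The singleton \<open>{{}}\<close> isolates the contribution 1 of the empty subgraph.\<close>
  have "(\<Sum>G\<in>{{}}. (\<Prod>e\<in>G. a e) * (measure_pmf.expectation ?W (\<lambda>w. \<Prod>e\<in>G. M w e))\<^sup>2) \<le> \<Delta> + 1"
    unfolding chi using a0 by (intro sum_mono2) (auto intro!: mult_nonneg_nonneg prod_nonneg)
  then show "0 \<le> \<Delta>" by simp
  obtain x0 where "x0 \<in> set_pmf F" using set_pmf_not_empty by fast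
  then have \<epsilon>: "\<epsilon> \<ge> 0" using me[of x0 x0] by (meson order_trans zero_le_power2)
  define b where "b i = sqrt (\<epsilon> / (1 - c\<^sup>2)) * \<theta> i" for i
  let ?Y = "Pi_pmf {..<n} 0 (\<lambda>_. skew_sign)"
  let ?y = "\<lambda>y :: nat \<Rightarrow> real. \<lambda>e. y (fst e) * y (snd e)"
  have Y: "finite (set_pmf ?Y)" by (intro finite_set_Pi_pmf) (auto simp: set_skew_sign)
  have ab: "a e * \<epsilon> \<le> b (fst e) * b (snd e)" if e: "e \<in> ?E" for e
  proof -
    note p = p[OF e]
    have "a e \<le> p e / (1 - c\<^sup>2)"
      unfolding a_def using p by (intro divide_left_mono mult_pos_pos) auto
    then have "a e * \<epsilon> \<le> p e / (1 - c\<^sup>2) * \<epsilon>" using \<epsilon> by (rule mult_right_mono)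
    also have "\<dots> = (sqrt (\<epsilon> / (1 - c\<^sup>2)))\<^sup>2 * p e" using p \<epsilon> by simp
    also have "\<dots> = b (fst e) * b (snd e)" by (simp add: b_def p_def power2_eq_square mult_ac)
    finally show ?thesis .
  qed
  have sum_b: "\<epsilon> / (1 - c\<^sup>2) * (\<Sum>i<n. (\<theta> i)\<^sup>2) = (\<Sum>i<n. (b i)\<^sup>2)"
  proof (cases "n = 0")
    case False
    then have "0 < c" using \<theta>[of 0] by linarith
    then have "c\<^sup>2 < 1" using c by (simp add: abs_square_less_1)
    then show ?thesis using \<epsilon> by (simp add: b_def power_mult_distrib sum_distrib_left)
  qed simp
  have b0: "0 \<le> b i" if "i < n" for i
  proof -
    have "0 < \<theta> i" "\<theta> i \<le> c" using \<theta>[OF that] by auto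
    moreover from this have "c\<^sup>2 < 1" using c by (simp add: abs_square_less_1)
    ultimately show ?thesis using \<epsilon> by (simp add: b_def)
  qed
  have "\<Delta> + 1 \<le> (\<Sum>G\<in>Pow ?E. measure_pmf.expectation ?Y (\<lambda>y. \<Prod>e\<in>G. b (fst e) * b (snd e) * ?y y e))"
    unfolding chi
  proof (rule sum_mono)
    fix G assume "G \<in> Pow ?E"
    then have G: "G \<subseteq> ?E" by simp
    have R0': "0 \<le> measure_pmf.expectation ?Y (\<lambda>y. \<Prod>e\<in>G. ?y y e)"
      unfolding prod_edges_eq_prod_degrees[OF G]
      by (subst expectation_prod_Pi_pmf_finite_support)
         (auto simp: set_skew_sign intro!: prod_nonneg skew_sign_moment_nonneg)
    have "(\<Prod>e\<in>G. a e) * (measure_pmf.expectation ?W (\<lambda>w. \<Prod>e\<in>G. M w e))\<^sup>2 \<le>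
          (\<Prod>e\<in>G. a e) * (\<epsilon> ^ card G * measure_pmf.expectation ?Y (\<lambda>y. \<Prod>e\<in>G. ?y y e))"
      unfolding M_def using a0 G
      by (intro mult_left_mono subgraph_mean_square_le_skew_sign F m0 me prod_nonneg) auto
    also have "\<dots> = (\<Prod>e\<in>G. a e * \<epsilon>) * measure_pmf.expectation ?Y (\<lambda>y. \<Prod>e\<in>G. ?y y e)"
      by (simp add: prod.distrib mult_ac)
    also have "\<dots> \<le> (\<Prod>e\<in>G. b (fst e) * b (snd e)) * measure_pmf.expectation ?Y (\<lambda>y. \<Prod>e\<in>G. ?y y e)"
      using G ab a0 \<epsilon> by (intro mult_right_mono R0' prod_mono) auto
    also have "\<dots> = measure_pmf.expectation ?Y (\<lambda>y. \<Prod>e\<in>G. b (fst e) * b (snd e) * ?y y e)"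
      by (simp add: prod.distrib)
    finally show "(\<Prod>e\<in>G. a e) * (measure_pmf.expectation ?W (\<lambda>w. \<Prod>e\<in>G. M w e))\<^sup>2 \<le> \<dots>" .
  qed
  also have "\<dots> = measure_pmf.expectation ?Y (\<lambda>y. \<Sum>G\<in>Pow ?E. \<Prod>e\<in>G. b (fst e) * b (snd e) * ?y y e)"
    using Y by (intro Bochner_Integration.integral_sum[symmetric] integrable_measure_pmf_finite)
  also have "\<dots> = measure_pmf.expectation ?Y (\<lambda>y. \<Prod>e\<in>?E. 1 + b (fst e) * b (snd e) * ?y y e)"
    using prod_add[OF finite_upper_pairs, of "\<lambda>e. b (fst e) * b (snd e) * ?y y e" "\<lambda>_. 1" n for y]
    by (simp add: add.commute)
  also have "\<dots> \<le> 1 / sqrt (1 - 9 / 4 * (\<Sum>i<n. (b i)\<^sup>2))"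
    by (rule skew_sign_chaos_le[OF b0 small[unfolded sum_b]])
  finally show "\<Delta> \<le> 1 / sqrt (1 - 9 / 4 * (\<epsilon> / (1 - c\<^sup>2) * (\<Sum>i<n. (\<theta> i)\<^sup>2))) - 1"
    unfolding sum_b by linarith
qed

lemma expectation_basis_vecs:
  fixes F :: "(real ^ 'k::finite) pmf" and g :: "real ^ 'k \<Rightarrow> 'b::{banach, second_countable_topology}"
  assumes "set_pmf F \<subseteq> basis_vecs"
  shows "measure_pmf.expectation F g = (\<Sum>k\<in>UNIV. pmf F (axis k 1) *\<^sub>R g (axis k 1))"
proof -
  have "inj (\<lambda>k::'k. axis k (1::real))" by (auto simp: inj_def axis_eq_axis)
  moreover have "measure_pmf.expectation F g = (\<Sum>x\<in>basis_vecs. pmf F x *\<^sub>R g x)"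
    using assms by (intro integral_measure_pmf) (auto simp: basis_vecs_def)
  ultimately show ?thesis by (simp add: basis_vecs_def sum.reindex)
qed

theorem theorem3p2:
  fixes F :: "(real ^ 'k::finite) pmf"
    and \<theta> :: "nat \<Rightarrow> nat \<Rightarrow> real"
    and P :: "nat \<Rightarrow> real ^ 'k ^ 'k"
    and d :: "nat \<Rightarrow> real ^ 'k"
    and c0 C :: real
  assumes K_gt_1: "CARD('k) > 1"
    and F_support: "set_pmf F \<subseteq> basis_vecs"
    and theta_pos: "\<And>n i. i < n \<Longrightarrow> \<theta> n i > 0"
    and P_sym: "\<And>n. transpose (P n) = P n"
    and P_nonneg: "\<And>n k l. P n $ k $ l \<ge> 0"
    and P_diag: "\<And>n k. P n $ k $ k = 1"
    and D_pos: "\<And>n k. d n $ k > 0"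
    and D_scaling: "\<And>n. (diag_mat (d n) ** P n ** diag_mat (d n)) *v mean_vec F = ones_vec"
    and omega_alt_prob:
      "\<And>n \<pi> i j. (\<And>m. m < n \<Longrightarrow> \<pi> m \<in> set_pmf F) \<Longrightarrow> i < j \<Longrightarrow> j < n \<Longrightarrow>
         omega_alt (\<theta> n) (P n) (d n) \<pi> i j \<in> {0..1}"
    and c0_less_1: "c0 < 1"
    and theta_max: "\<And>n. n > 0 \<Longrightarrow> Max (\<theta> n ` {..<n}) \<le> c0"
    and C_pos: "C > 0"
    and h_min: "Min (range (\<lambda>k. mean_vec F $ k)) \<ge> C"
    and mu2: "(\<lambda>n. L2_set (\<theta> n) {..<n} * \<bar>eig_mag 2 (P n)\<bar>) \<longlonglongrightarrow> 0"
  shows "(\<lambda>n. chi2_dist (measure_pmf (null_law n (\<theta> n)))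
                         (measure_pmf (alt_law n F (\<theta> n) (P n) (d n)))) \<longlonglongrightarrow> 0"
proof -
  define h where "h k = mean_vec F $ k" for k
  have hF: "h k = pmf F (axis k 1)" for k
    by (simp add: h_def mean_vec_def expectation_basis_vecs[OF F_support] axis_def if_distrib cong: if_cong)
  have hC: "C \<le> h k" for k
    using h_min by (simp add: h_def)
  then have h_pos: "0 < h k" for k using C_pos by (meson less_le_trans)
  have h_sum: "(\<Sum>k\<in>UNIV. h k) = 1"
    using expectation_basis_vecs[OF F_support, of "\<lambda>_. 1 :: real"] by (simp add: hF)
  have finF: "finite (set_pmf F)"
    using F_support by (rule finite_subset) (simp add: basis_vecs_def)
  have stoch: "(\<Sum>l\<in>UNIV. d n $ k * P n $ k $ l * d n $ l * h l) = 1" for n k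
    using arg_cong[OF D_scaling[of n], of "\<lambda>v. v $ k"]
    by (simp add: diag_mat_def ones_vec_def matrix_vector_mult_def matrix_matrix_mult_def h_def
        if_distrib if_distribR cong: if_cong)
  define lab where "lab x = (THE k. x = axis k (1::real))" for x :: "real ^ 'k"
  have lab: "lab (axis k 1) = k" for k by (simp add: lab_def axis_eq_axis)
  \<comment> \<open>The centred kernel: on basis vectors \<open>e\<^sub>k\<close>, \<open>e\<^sub>l\<close> it is entry \<open>(k, l)\<close> of \<open>D P D\<close>, less 1.\<close>
  define m where "m n x y = d n $ lab x * d n $ lab y * (x \<bullet> (P n *v y)) - 1" for n x y
  have m_axis: "m n (axis k 1) (axis l 1) = d n $ k * d n $ l * P n $ k $ l - 1" for n k l
    by (simp add: m_def lab inner_axis' matrix_vector_mult_basis column_def)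
  have supp: "\<exists>k. x = axis k 1" if "x \<in> set_pmf F" for x
    using that F_support by (auto simp: basis_vecs_def)
  have Psym: "P n $ k $ l = P n $ l $ k" for n k l
    using arg_cong[OF P_sym[of n], of "\<lambda>A. A $ l $ k"] by (simp add: transpose_def)
  have m_sym: "m n (axis k 1) (axis l 1) = m n (axis l 1) (axis k 1)" for n k l
    by (simp add: m_axis Psym[of n k l])
  have m0: "measure_pmf.expectation F (\<lambda>x. m n y x) = 0"
    and m0': "measure_pmf.expectation F (\<lambda>x. m n x y) = 0" if y: "y \<in> set_pmf F" for n y
  proof -
    obtain k where k: "y = axis k 1" using supp[OF y] by blast
    have "measure_pmf.expectation F (\<lambda>x. m n y x) =
            (\<Sum>l\<in>UNIV. d n $ k * P n $ k $ l * d n $ l * h l - h l)"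
      unfolding expectation_basis_vecs[OF F_support] k m_axis hF[symmetric]
      by (intro sum.cong) (auto simp: algebra_simps)
    then show *: "measure_pmf.expectation F (\<lambda>x. m n y x) = 0"
      by (simp add: sum_subtractf stoch h_sum)
    then show "measure_pmf.expectation F (\<lambda>x. m n x y) = 0"
      unfolding expectation_basis_vecs[OF F_support] k by (simp add: m_sym[of n _ k])
  qed
  have m_le: "(m n x y)\<^sup>2 \<le> (eig_mag 2 (P n))\<^sup>2 / C\<^sup>2" if xy: "x \<in> set_pmf F" "y \<in> set_pmf F" for n x y
  proof -
    obtain k l where kl: "x = axis k 1" "y = axis l 1" using supp[OF xy(1)] supp[OF xy(2)] by blast
    have "C * C * (m n x y)\<^sup>2 \<le> h k * h l * (m n x y)\<^sup>2"
      using hC C_pos by (intro mult_right_mono mult_mono) (auto intro: order_trans less_imp_le)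
    also have "\<dots> \<le> (eig_mag 2 (P n))\<^sup>2"
      unfolding kl m_axis
      by (intro second_eigenvalue_bounds_centred_kernel K_gt_1 P_sym P_nonneg P_diag D_pos h_pos h_sum stoch)
    finally show ?thesis using C_pos by (simp add: field_simps power2_eq_square)
  qed
  have omega: "omega_alt (\<theta> n) (P n) (d n) \<pi> i j = \<theta> n i * \<theta> n j * (1 + m n (\<pi> i) (\<pi> j))" for n \<pi> i j
    by (simp add: omega_alt_def theta_tilde_def m_def lab_def)
  have alt: "alt_law n F (\<theta> n) (P n) (d n) = Pi_pmf {..<n} 0 (\<lambda>_. F) \<bind>
      (\<lambda>\<pi>. adj_law n (\<lambda>i j. \<theta> n i * \<theta> n j * (1 + m n (\<pi> i) (\<pi> j))))" for n
    unfolding alt_law_def omega[symmetric] by simp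
  \<comment> \<open>Up to a constant, \<open>s n\<close> is the square of the quantity assumed to tend to zero.\<close>
  define s where "s n = (eig_mag 2 (P n))\<^sup>2 / C\<^sup>2 / (1 - c0\<^sup>2) * (\<Sum>i<n. (\<theta> n i)\<^sup>2)" for n
  have "s = (\<lambda>n. (L2_set (\<theta> n) {..<n} * \<bar>eig_mag 2 (P n)\<bar>)\<^sup>2 * (1 / (C\<^sup>2 * (1 - c0\<^sup>2))))"
    by (rule ext) (simp add: s_def L2_set_def power_mult_distrib sum_nonneg)
  moreover have "(\<lambda>n. (L2_set (\<theta> n) {..<n} * \<bar>eig_mag 2 (P n)\<bar>)\<^sup>2 * (1 / (C\<^sup>2 * (1 - c0\<^sup>2)))) \<longlonglongrightarrow> 0\<^sup>2 * (1 / (C\<^sup>2 * (1 - c0\<^sup>2)))"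
    by (intro tendsto_intros mu2)
  ultimately have s0: "s \<longlonglongrightarrow> 0" by (simp only: power_zero_numeral mult_zero_left)
  have "(\<lambda>n. 1 / sqrt (1 - 9 / 4 * s n) - 1) \<longlonglongrightarrow> 1 / sqrt (1 - 9 / 4 * 0) - 1"
    by (intro tendsto_intros s0) auto
  then have upper: "(\<lambda>n. 1 / sqrt (1 - 9 / 4 * s n) - 1) \<longlonglongrightarrow> 0" by simp
  have small: "eventually (\<lambda>n. s n \<le> 1 / 4) sequentially"
    using order_tendstoD(2)[OF s0, of "1 / 4"] by (auto elim: eventually_mono)
  have bounds: "0 \<le> chi2_dist (measure_pmf (null_law n (\<theta> n))) (measure_pmf (alt_law n F (\<theta> n) (P n) (d n))) \<and>
    chi2_dist (measure_pmf (null_law n (\<theta> n))) (measure_pmf (alt_law n F (\<theta> n) (P n) (d n)))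
       \<le> 1 / sqrt (1 - 9 / 4 * s n) - 1" if sn: "s n \<le> 1 / 4" for n
  proof -
    have th: "0 < \<theta> n i \<and> \<theta> n i \<le> c0" if "i < n" for i
      using theta_max[of n] that theta_pos[OF that] by (auto simp: Max_le_iff lessThan_empty_iff)
    show ?thesis
      unfolding alt s_def
      using chi2_centred_kernel_bounds[OF finF th c0_less_1 m0' m0 m_le omega_alt_prob[unfolded omega] sn[unfolded s_def]]
      by blast
  qed
  show ?thesis
    by (rule tendsto_sandwich[OF _ _ tendsto_const upper])
       (use small bounds in \<open>auto elim!: eventually_mono\<close>)
qed

end
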